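(* Let $G=\mathbb{Z}_{3,0}^{4}\rtimes S_4$, where $S_4$ acts on $\mathbb{Z}_{3,0}^4$ by permuting coordinates. Then $\mathrm{mdim}_{\mathbb{C}}(G)=4$ and $\mathrm{mdim}_{\mathbb{R}}(G)=6$. Every faithful complex representation of $G$ of dimension $4$ is irreducible and non-real; consequently no faithful real representation of $G$ of minimal dimension $6$ is obtained as the realification of a faithful complex representation of minimal dimension $4$.
   Context: For integers $k>1$, $m>0$, $\mathbb{Z}_{k,0}^m$ is the kernel of the homomorphism $\mathbb{Z}_k^m\to\mathbb{Z}_k$ sending an $m$-tuple to the sum of its entries. For a finite group $G$ and field $F$, $\mathrm{mdim}_F(G)$ is the smallest dimension of a faithful representation of $G$ over $F$. A complex representation is called real if it is obtained by extension of scalars from a representation over $\mathbb{R}$, and non-real otherwise. The realification of a complex representation $V$, decomposed as a sum of irreducible real pieces $V_i$ and irreducible non-real pieces $W_j$, is $V\oplus\bigoplus_j\overline{W_j}$, which is realizable over $\mathbb{R}$. *)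

theory Defs
  imports Complex_Main "HOL-Combinatorics.Permutations" "Jordan_Normal_Form.Matrix"
begin

text \<open>Elements are pairs (v, sigma): v : nat => nat with values in {0,1,2}, supported on
  {0..3}, entry sum divisible by 3 (an element of Z_{3,0}^4); sigma a permutation of {0..3}.
  S_4 acts by permuting coordinates: (sigma . w)(i) = w(sigma^-1 i), and
  (v,sigma)(w,tau) = (v + sigma . w, sigma o tau).\<close>

type_synonym gelem = "(nat \<Rightarrow> nat) \<times> (nat \<Rightarrow> nat)"

definition Z30_4 :: "(nat \<Rightarrow> nat) set" where
  "Z30_4 = {v. (\<forall>i. v i < 3) \<and> (\<forall>i\<ge>4. v i = 0) \<and> (\<Sum>i<4. v i) mod 3 = 0}"

definition S4 :: "(nat \<Rightarrow> nat) set" where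
  "S4 = {\<sigma>. \<sigma> permutes {..<4}}"

definition G_carrier :: "gelem set" where
  "G_carrier = Z30_4 \<times> S4"

definition G_mult :: "gelem \<Rightarrow> gelem \<Rightarrow> gelem" where
  "G_mult x y = ((\<lambda>i. if i < 4 then (fst x i + fst y (inv_into UNIV (snd x) i)) mod 3 else 0),
                 snd x \<circ> snd y)"

definition G_one :: gelem where
  "G_one = ((\<lambda>_. 0), id)"

definition is_rep :: "nat \<Rightarrow> (gelem \<Rightarrow> 'a::field mat) \<Rightarrow> bool" where
  "is_rep n \<rho> \<longleftrightarrow> (\<forall>g\<in>G_carrier. \<rho> g \<in> carrier_mat n n) \<and> \<rho> G_one = 1\<^sub>m n \<and>
     (\<forall>g\<in>G_carrier. \<forall>h\<in>G_carrier. \<rho> (G_mult g h) = \<rho> g * \<rho> h)"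

definition faithful_rep :: "nat \<Rightarrow> (gelem \<Rightarrow> 'a::field mat) \<Rightarrow> bool" where
  "faithful_rep n \<rho> \<longleftrightarrow> is_rep n \<rho> \<and> inj_on \<rho> G_carrier"

definition mdim :: "'a::field itself \<Rightarrow> nat" where
  "mdim (_ :: 'a itself) = (LEAST n. \<exists>\<rho> :: gelem \<Rightarrow> 'a mat. faithful_rep n \<rho>)"

definition invariant_subspace :: "nat \<Rightarrow> (gelem \<Rightarrow> 'a::field mat) \<Rightarrow> 'a vec set \<Rightarrow> bool" where
  "invariant_subspace n \<rho> W \<longleftrightarrow> W \<subseteq> carrier_vec n \<and> 0\<^sub>v n \<in> W \<and>
     (\<forall>v\<in>W. \<forall>w\<in>W. v + w \<in> W) \<and> (\<forall>c. \<forall>v\<in>W. c \<cdot>\<^sub>v v \<in> W) \<and>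
     (\<forall>g\<in>G_carrier. \<forall>v\<in>W. \<rho> g *\<^sub>v v \<in> W)"

definition irred_rep :: "nat \<Rightarrow> (gelem \<Rightarrow> 'a::field mat) \<Rightarrow> bool" where
  "irred_rep n \<rho> \<longleftrightarrow> is_rep n \<rho> \<and> n > 0 \<and>
     (\<forall>W. invariant_subspace n \<rho> W \<longrightarrow> W = {0\<^sub>v n} \<or> W = carrier_vec n)"

definition iso_rep :: "nat \<Rightarrow> (gelem \<Rightarrow> 'a::field mat) \<Rightarrow> (gelem \<Rightarrow> 'a mat) \<Rightarrow> bool" where
  "iso_rep n \<rho> \<tau> \<longleftrightarrow> (\<exists>P \<in> carrier_mat n n. invertible_mat P \<and>
     (\<forall>g\<in>G_carrier. P * \<rho> g = \<tau> g * P))"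

definition complexify :: "(gelem \<Rightarrow> real mat) \<Rightarrow> (gelem \<Rightarrow> complex mat)" where
  "complexify \<sigma> = (\<lambda>g. map_mat complex_of_real (\<sigma> g))"

definition real_rep :: "nat \<Rightarrow> (gelem \<Rightarrow> complex mat) \<Rightarrow> bool" where
  "real_rep n \<rho> \<longleftrightarrow> is_rep n \<rho> \<and>
     (\<exists>\<sigma> :: gelem \<Rightarrow> real mat. is_rep n \<sigma> \<and> iso_rep n \<rho> (complexify \<sigma>))"

definition conj_rep :: "(gelem \<Rightarrow> complex mat) \<Rightarrow> (gelem \<Rightarrow> complex mat)" where
  "conj_rep \<rho> = (\<lambda>g. map_mat cnj (\<rho> g))"

definition rep_sum :: "nat \<Rightarrow> (gelem \<Rightarrow> 'a::field mat) \<Rightarrow> nat \<Rightarrow> (gelem \<Rightarrow> 'a mat)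
     \<Rightarrow> (gelem \<Rightarrow> 'a mat)" where
  "rep_sum n \<rho> m \<tau> = (\<lambda>g. four_block_mat (\<rho> g) (0\<^sub>m n m) (0\<^sub>m m n) (\<tau> g))"

fun rep_sum_list :: "(nat \<times> (gelem \<Rightarrow> 'a::field mat)) list \<Rightarrow> nat \<times> (gelem \<Rightarrow> 'a mat)" where
  "rep_sum_list [] = (0, (\<lambda>g. 1\<^sub>m 0))"
| "rep_sum_list ((d, r) # xs) =
     (d + fst (rep_sum_list xs), rep_sum d r (fst (rep_sum_list xs)) (snd (rep_sum_list xs)))"

text \<open>realification n rho k tau: tau (of dimension k) is (isomorphic to) the realification
  V + sum_j conj(W_j) of rho (dimension n), for some decomposition of rho into irreducible
  pieces, W_j ranging over the non-real irreducible pieces.\<close>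
definition realification :: "nat \<Rightarrow> (gelem \<Rightarrow> complex mat) \<Rightarrow> nat \<Rightarrow> (gelem \<Rightarrow> complex mat) \<Rightarrow> bool" where
  "realification n \<rho> k \<tau> \<longleftrightarrow> is_rep n \<rho> \<and>
     (\<exists>ds. (\<forall>(d, r) \<in> set ds. irred_rep d r) \<and>
        fst (rep_sum_list ds) = n \<and> iso_rep n \<rho> (snd (rep_sum_list ds)) \<and>
        (let nr = rep_sum_list [(d, conj_rep r). (d, r) \<leftarrow> ds, \<not> real_rep d r] in
           k = n + fst nr \<and> iso_rep k \<tau> (rep_sum n \<rho> (fst nr) (snd nr))))"

end

(* The elements b_i = e_i - (1,1,1,1) of Z_{3,0}^4 commute, have order 3, sum to 0, generate and are
   permuted by S_4. So a complex representation has joint eigenvectors of the b_i, whose weights are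
   quadruples of cube roots of unity with product 1, and the set of weights is closed under
   S_4 (and under conjugation, if the representation is real). Joint eigenvectors of different
   weights are linearly independent. A faithful representation has a nontrivial weight; this has
   at least 4 different permutations, and at least 6 if conjugates are included. In dimension 4,
   any nonzero invariant subspace therefore contains 4 independent vectors. The bounds are
   attained by the monomial representations on the vertices and (in a real form) on the edges of
   the tetrahedron. *)

theory Submission
  imports Defs "Jordan_Normal_Form.Determinant"
begin

subsection \<open>Joint eigenvectors\<close>

text \<open>The constants come from the quadruples of exponents mod 3 with sum 0. Up to permutation
  the nonzero ones are (0,1,1,1), (0,2,2,2), (1,1,2,2) and (0,0,1,2), with 4, 4, 6 and 12
  arrangements. Conjugation doubles the exponents: it interchanges the first two classes and
  preserves each of the other two. A set closed under both actions with a nonzero member therefore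
  has at least 6 elements, and (1,1,2,2) attains this. The weights of a faithful representation of
  dimension 4 form one of the first two classes, while a real representation containing one of these
  contains both. So the realification has dimension 8 and overshoots 6: the minimal real
  representation sits on a different orbit. Counting permutations alone does not give
  irreducibility, since an invariant subspace might carry only the zero weight. Counting zero
  together with an orbit excludes this: five weights do not fit into dimension 4.\<close>

definition lin_closed :: "nat \<Rightarrow> 'a::field vec set \<Rightarrow> bool" where
  "lin_closed n W \<longleftrightarrow> W \<subseteq> carrier_vec n \<and> 0\<^sub>v n \<in> W \<and>
     (\<forall>v\<in>W. \<forall>w\<in>W. v + w \<in> W) \<and> (\<forall>c. \<forall>v\<in>W. c \<cdot>\<^sub>v v \<in> W)"

definition lin_indep :: "nat \<Rightarrow> nat \<Rightarrow> (nat \<Rightarrow> 'a::field vec) \<Rightarrow> bool" where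
  "lin_indep n m w \<longleftrightarrow> (\<forall>c. (\<forall>j<n. (\<Sum>k<m. c k * w k $ j) = 0) \<longrightarrow> (\<forall>k<m. c k = 0))"

lemma lin_indepD:
  "lin_indep n m w \<Longrightarrow> (\<And>j. j < n \<Longrightarrow> (\<Sum>k<m. c k * w k $ j) = 0) \<Longrightarrow> k < m \<Longrightarrow> c k = 0"
  unfolding lin_indep_def by blast

text \<open>With more vectors than coordinates, zero rows complete the matrix of columns
  \<open>w k\<close> to a square one. Its row \<open>n\<close> is zero, so the transpose kills
  \<open>unit_vec m n\<close>, the determinant vanishes, and a kernel vector is a forbidden
  relation.\<close>

lemma lin_indep_le_dim:
  assumes "lin_indep n m w"
  shows "m \<le> n"
proof (rule ccontr)
  assume "\<not> m \<le> n"
  then have nm: "n < m" by simp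
  define M where "M = mat m m (\<lambda>(j, k). if j < n then w k $ j else 0)"
  have M: "M \<in> carrier_mat m m" unfolding M_def by simp
  have "M\<^sup>T *\<^sub>v unit_vec m n = 0\<^sub>v m"
    using nm by (intro eq_vecI) (auto simp: M_def)
  moreover have "unit_vec m n \<noteq> (0\<^sub>v m :: 'a vec)" using nm by simp
  ultimately have "det M\<^sup>T = 0"
    using det_0_iff_vec_prod_zero_field[of "M\<^sup>T" m] M
    by (metis transpose_carrier_mat unit_vec_carrier)
  then have "det M = 0" using det_transpose[OF M] by simp
  then obtain c where c: "c \<in> carrier_vec m" "c \<noteq> 0\<^sub>v m" "M *\<^sub>v c = 0\<^sub>v m"
    using det_0_iff_vec_prod_zero_field[OF M] by blast
  have "c $ k = 0" if "k < m" for k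
  proof (rule lin_indepD[OF assms _ that])
    fix j assume j: "j < n"
    have "(M *\<^sub>v c) $ j = (\<Sum>k<m. w k $ j * c $ k)"
      using j nm c(1) by (auto simp: M_def scalar_prod_def lessThan_atLeast0)
    then show "(\<Sum>k<m. c $ k * w k $ j) = 0" using c(3) j nm by (simp add: mult.commute)
  qed
  then show False using c(1,2) by (auto intro!: eq_vecI)
qed

lemma lin_indep_spans:
  assumes ind: "lin_indep n n w" and u: "u \<in> carrier_vec n"
  obtains x where "\<And>j. j < n \<Longrightarrow> u $ j = (\<Sum>k<n. x k * w k $ j)"
proof -
  define M where "M = mat n n (\<lambda>(j, k). w k $ j)"
  have M: "M \<in> carrier_mat n n" unfolding M_def by simp
  have Mc: "(M *\<^sub>v c) $ j = (\<Sum>k<n. c $ k * w k $ j)" if "c \<in> carrier_vec n" "j < n" for c j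
    using that by (auto simp: M_def scalar_prod_def lessThan_atLeast0 mult.commute)
  have "det M \<noteq> 0"
  proof
    assume "det M = 0"
    then obtain c where c: "c \<in> carrier_vec n" "c \<noteq> 0\<^sub>v n" "M *\<^sub>v c = 0\<^sub>v n"
      using det_0_iff_vec_prod_zero_field[OF M] by blast
    have "c $ k = 0" if "k < n" for k
      using lin_indepD[OF ind _ that, of "\<lambda>k. c $ k"] c(3) Mc[OF c(1)] by simp
    then show False using c(1,2) by (auto intro!: eq_vecI)
  qed
  then have "M \<in> Units (ring_mat TYPE('a) n ())"
    by (rule det_non_zero_imp_unit[OF M])
  then obtain B where B: "B \<in> carrier_mat n n" "M * B = 1\<^sub>m n"
    unfolding Units_def by (auto simp: ring_mat_def)
  have "M *\<^sub>v (B *\<^sub>v u) = u"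
    using assoc_mult_mat_vec[OF M B(1) u] B(2) u by simp
  moreover have "B *\<^sub>v u \<in> carrier_vec n" using B(1) u by simp
  ultimately show ?thesis using that[of "\<lambda>k. (B *\<^sub>v u) $ k"] Mc by metis
qed

lemma lin_closed_sum:
  fixes w :: "nat \<Rightarrow> 'a::field vec"
  assumes W: "lin_closed n W" and w: "\<And>k. k < m \<Longrightarrow> w k \<in> W"
  shows "vec n (\<lambda>j. \<Sum>k<m. x k * w k $ j) \<in> W"
  using w
proof (induction m)
  case 0
  then show ?case using W unfolding lin_closed_def zero_vec_def by simp
next
  case (Suc m)
  have wm: "w m \<in> W" using Suc.prems by simp
  have *: "vec n (\<lambda>j. \<Sum>k<Suc m. x k * w k $ j)
      = vec n (\<lambda>j. \<Sum>k<m. x k * w k $ j) + x m \<cdot>\<^sub>v w m"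
    using wm W unfolding lin_closed_def by (intro eq_vecI) auto
  have "vec n (\<lambda>j. \<Sum>k<m. x k * w k $ j) \<in> W" using Suc by simp
  then show ?case unfolding * using wm W unfolding lin_closed_def by blast
qed

lemma lin_indep_closed_eq_carrier:
  assumes W: "lin_closed n W" and w: "\<And>k. k < n \<Longrightarrow> w k \<in> W" and ind: "lin_indep n n w"
  shows "W = carrier_vec n"
proof
  show "W \<subseteq> carrier_vec n" using W unfolding lin_closed_def by blast
  show "carrier_vec n \<subseteq> W"
  proof
    fix u :: "'a vec" assume u: "u \<in> carrier_vec n"
    obtain x where x: "\<And>j. j < n \<Longrightarrow> u $ j = (\<Sum>k<n. x k * w k $ j)"
      using lin_indep_spans[OF ind u] by blast
    have "u = vec n (\<lambda>j. \<Sum>k<n. x k * w k $ j)" using u x by (intro eq_vecI) auto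
    then show "u \<in> W" using lin_closed_sum[OF W w] by simp
  qed
qed

text \<open>Subtracting \<open>ev t i\<close> times the relation from its image under
  \<open>A i\<close> removes \<open>t\<close> and multiplies the coefficient of each other
  \<open>s\<close> by \<open>ev s i - ev t i\<close>. The index \<open>i\<close> is chosen to
  separate one given \<open>r\<close> from \<open>t\<close>, and the induction hypothesis is read
  off at \<open>r\<close> alone, so the other factors may vanish.\<close>

lemma joint_eigenvectors_relation:
  fixes A :: "'i \<Rightarrow> 'a::field mat" and w :: "'k \<Rightarrow> 'a vec"
  assumes A: "\<And>i. i \<in> I \<Longrightarrow> A i \<in> carrier_mat n n"
    and "finite S"
    and "\<And>s. s \<in> S \<Longrightarrow> w s \<in> carrier_vec n" "\<And>s. s \<in> S \<Longrightarrow> w s \<noteq> 0\<^sub>v n"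
    and "\<And>s i. s \<in> S \<Longrightarrow> i \<in> I \<Longrightarrow> A i *\<^sub>v w s = ev s i \<cdot>\<^sub>v w s"
    and "\<And>s t. s \<in> S \<Longrightarrow> t \<in> S \<Longrightarrow> s \<noteq> t \<Longrightarrow> \<exists>i\<in>I. ev s i \<noteq> ev t i"
    and "\<And>j. j < n \<Longrightarrow> (\<Sum>s\<in>S. c s * w s $ j) = 0"
    and "s \<in> S"
  shows "c s = 0"
  using assms(2-)
proof (induction S arbitrary: c s rule: finite_induct)
  case empty
  then show ?case by simp
next
  case (insert t S)
  have S0: "c r = 0" if r: "r \<in> S" for r
  proof -
    have "r \<noteq> t" using r insert.hyps by auto
    then obtain i where i: "i \<in> I" "ev r i \<noteq> ev t i" using insert.prems(4)[of r t] r by auto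
    have "(\<Sum>s\<in>S. (c s * (ev s i - ev t i)) * w s $ j) = 0" if j: "j < n" for j
    proof -
      have Aw: "(\<Sum>k<n. A i $$ (j, k) * w s $ k) = ev s i * w s $ j" if s: "s \<in> insert t S" for s
      proof -
        have "(A i *\<^sub>v w s) $ j = (\<Sum>k<n. A i $$ (j, k) * w s $ k)"
          using A[OF i(1)] insert.prems(1)[OF s] j
          by (auto simp: scalar_prod_def lessThan_atLeast0)
        then show ?thesis using insert.prems(1,3)[OF s] i(1) j by auto
      qed
      have "0 = (\<Sum>k<n. A i $$ (j, k) * (\<Sum>s\<in>insert t S. c s * w s $ k))"
        using insert.prems(5) by simp
      also have "\<dots> = (\<Sum>s\<in>insert t S. c s * (\<Sum>k<n. A i $$ (j, k) * w s $ k))"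
        unfolding sum_distrib_left by (subst sum.swap) (simp add: mult_ac)
      also have "\<dots> = (\<Sum>s\<in>insert t S. c s * (ev s i * w s $ j))"
        using Aw by (intro sum.cong) auto
      finally have 1: "(\<Sum>s\<in>insert t S. c s * (ev s i * w s $ j)) = 0" by simp
      have "(\<Sum>s\<in>insert t S. c s * (ev s i - ev t i) * w s $ j)
          = (\<Sum>s\<in>insert t S. c s * (ev s i * w s $ j)) - ev t i * (\<Sum>s\<in>insert t S. c s * w s $ j)"
        unfolding sum_distrib_left sum_subtractf[symmetric] by (simp add: algebra_simps)
      also have "\<dots> = 0" using 1 insert.prems(5)[OF j] by simp
      finally show ?thesis using insert.hyps by simp
    qed
    then have "c r * (ev r i - ev t i) = 0"
      using insert.IH[of "\<lambda>s. c s * (ev s i - ev t i)" r] insert.prems(1-4) r by auto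
    then show ?thesis using i(2) by simp
  qed
  moreover have "c t = 0"
  proof -
    obtain j where j: "j < n" "w t $ j \<noteq> 0"
      using insert.prems(1,2)[of t] by (metis carrier_vecD eq_vecI index_zero_vec insertI1)
    have "(\<Sum>s\<in>insert t S. c s * w s $ j) = c t * w t $ j" using S0 insert.hyps by simp
    then show ?thesis using insert.prems(5)[OF j(1)] j(2) by simp
  qed
  ultimately show ?case using insert.prems(6) by auto
qed

subsection \<open>Weights of commuting cube roots of the identity\<close>

definition \<omega> :: complex where "\<omega> = cis (2 * pi / 3)"

lemma \<omega>_cube: "\<omega> ^ 3 = 1"
  by (simp add: \<omega>_def DeMoivre)

lemma \<omega>_Re_Im: "Re \<omega> = - 1 / 2" "Im \<omega> = sqrt 3 / 2"
  by (simp_all add: \<omega>_def cos_120 sin_120)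

lemma \<omega>_sum: "1 + \<omega> + \<omega>\<^sup>2 = 0"
  by (simp add: complex_eq_iff \<omega>_Re_Im power2_eq_square)

lemma \<omega>_squared: "\<omega>\<^sup>2 = - 1 - \<omega>"
  using \<omega>_sum by (simp add: eq_neg_iff_add_eq_0 algebra_simps)

lemma \<omega>_neq_0: "\<omega> \<noteq> 0"
  by (simp add: complex_eq_iff \<omega>_Re_Im)

lemma \<omega>_mod: "\<omega> ^ (k mod 3) = \<omega> ^ k"
proof -
  have "\<omega> ^ k = \<omega> ^ (3 * (k div 3) + k mod 3)" by simp
  also have "\<dots> = \<omega> ^ (k mod 3)" unfolding power_add power_mult \<omega>_cube by simp
  finally show ?thesis by simp
qed

lemma \<omega>_eq_iff: "\<omega> ^ a = \<omega> ^ b \<longleftrightarrow> a mod 3 = b mod 3"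
proof -
  have *: "x = y" if "x < 3" "y < 3" "\<omega> ^ x = \<omega> ^ y" for x y
  proof -
    have "x = 0 \<or> x = 1 \<or> x = 2" "y = 0 \<or> y = 1 \<or> y = 2" using that by auto
    then show ?thesis using that(3)
      by (auto simp: \<omega>_squared) (auto simp: complex_eq_iff \<omega>_Re_Im)
  qed
  show ?thesis
  proof
    assume "\<omega> ^ a = \<omega> ^ b"
    then have "\<omega> ^ (a mod 3) = \<omega> ^ (b mod 3)" by (simp add: \<omega>_mod)
    then show "a mod 3 = b mod 3" using *[of "a mod 3" "b mod 3"] by simp
  next
    assume "a mod 3 = b mod 3"
    then show "\<omega> ^ a = \<omega> ^ b" using \<omega>_mod[of a] \<omega>_mod[of b] by simp
  qed
qed

text \<open>The reduction mod 3 keeps the exponent in the range demanded by \<open>weights\<close>,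
  so that conjugation acts on exponent lists by
  \<open>map (\<lambda>a. 2 * a mod 3)\<close>.\<close>

lemma cnj_\<omega>_power: "cnj (\<omega> ^ a) = \<omega> ^ (2 * a mod 3)"
proof -
  have "cnj \<omega> = \<omega>\<^sup>2" by (simp add: \<omega>_squared complex_eq_iff \<omega>_Re_Im)
  then show ?thesis unfolding \<omega>_mod by (simp add: power_mult)
qed

lemma lin_closedD:
  assumes "lin_closed n W"
  shows "v \<in> W \<Longrightarrow> v \<in> carrier_vec n" "v \<in> W \<Longrightarrow> w \<in> W \<Longrightarrow> v + w \<in> W" "v \<in> W \<Longrightarrow> c \<cdot>\<^sub>v v \<in> W"
  using assms unfolding lin_closed_def by blast+

text \<open>The vectors \<open>w + \<omega>\<^sup>2\<^sup>a A w + \<omega>\<^sup>a A\<^sup>2 w\<close> for \<open>a = 0, 1, 2\<close> are the (scaled) components of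
  \<open>w\<close> in the three eigenspaces of \<open>A\<close>.\<close>

lemma cube_root_eigenvector:
  assumes A: "A \<in> carrier_mat n n" and cube: "A * (A * A) = 1\<^sub>m n"
    and W: "lin_closed n W" and AW: "\<And>v. v \<in> W \<Longrightarrow> A *\<^sub>v v \<in> W" and w: "w \<in> W"
  shows "w \<noteq> 0\<^sub>v n \<Longrightarrow> \<exists>a<3. \<exists>u\<in>W. u \<noteq> 0\<^sub>v n \<and> A *\<^sub>v u = \<omega> ^ a \<cdot>\<^sub>v u"
    and "A *\<^sub>v w \<noteq> w \<Longrightarrow> \<exists>a\<in>{1,2}. \<exists>u\<in>W. u \<noteq> 0\<^sub>v n \<and> A *\<^sub>v u = \<omega> ^ a \<cdot>\<^sub>v u"
proof -
  define y where "y = A *\<^sub>v w"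
  define z where "z = A *\<^sub>v y"
  define u where "u a = w + (\<omega> ^ (2 * a) \<cdot>\<^sub>v y + \<omega> ^ a \<cdot>\<^sub>v z)" for a
  have yz: "y \<in> W" "z \<in> W" using AW w unfolding y_def z_def by auto
  have car: "w \<in> carrier_vec n" "y \<in> carrier_vec n" "z \<in> carrier_vec n"
    using lin_closedD(1)[OF W] w yz by auto
  have Az: "A *\<^sub>v z = w"
    using assoc_mult_mat_vec[OF A _ car(1), of "A * A"] assoc_mult_mat_vec[OF A A car(1)] A cube car
    unfolding z_def y_def by simp
  have u: "u a \<in> W" for a
    unfolding u_def by (intro lin_closedD[OF W] w yz)
  have Au: "A *\<^sub>v u a = \<omega> ^ a \<cdot>\<^sub>v u a" for a
  proof -
    have "A *\<^sub>v u a = y + (\<omega> ^ (2 * a) \<cdot>\<^sub>v z + \<omega> ^ a \<cdot>\<^sub>v w)"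
      unfolding u_def using A car Az
      by (simp add: mult_add_distrib_mat_vec[OF A] mult_mat_vec[OF A] flip: y_def z_def)
    moreover have "\<dots> = \<omega> ^ a \<cdot>\<^sub>v u a"
    proof (rule eq_vecI)
      fix j assume "j < dim_vec (\<omega> ^ a \<cdot>\<^sub>v u a)"
      then have j: "j < n" unfolding u_def using car by simp
      have sq: "\<omega> ^ (2 * a) = \<omega> ^ a * \<omega> ^ a" by (simp add: mult_2 power_add)
      have "\<omega> ^ (3 * a) = 1" unfolding power_mult \<omega>_cube by simp
      then have "\<omega> ^ a * (\<omega> ^ a * (\<omega> ^ a * y $ j)) = y $ j"
        by (simp add: numeral_3_eq_3 power_add flip: mult.assoc)
      then have "y $ j + (\<omega> ^ a * \<omega> ^ a * z $ j + \<omega> ^ a * w $ j)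
          = \<omega> ^ a * (w $ j + (\<omega> ^ a * \<omega> ^ a * y $ j + \<omega> ^ a * z $ j))"
        by (simp add: distrib_left mult.assoc)
      then show "(y + (\<omega> ^ (2 * a) \<cdot>\<^sub>v z + \<omega> ^ a \<cdot>\<^sub>v w)) $ j = (\<omega> ^ a \<cdot>\<^sub>v u a) $ j"
        unfolding u_def sq using car j by simp
    qed (use car in \<open>simp add: u_def\<close>)
    ultimately show ?thesis by simp
  qed
  have u_index: "u a $ j = w $ j + \<omega> ^ (2 * a) * y $ j + \<omega> ^ a * z $ j" if "j < n" for a j
    unfolding u_def using car that by simp
  \<comment> \<open>If both nontrivial components vanish, \<open>w\<close> lies in the eigenspace of
    1. The difference of the two relations gives \<open>y = z\<close>, and the first one then reads
    \<open>w - y = 0\<close>.\<close>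
  have *: "w $ j = y $ j" if "u 1 = 0\<^sub>v n" "u 2 = 0\<^sub>v n" "j < n" for j
  proof -
    have w4: "\<omega> ^ 4 = \<omega>" using \<omega>_cube by (simp add: numeral_eq_Suc)
    have 1: "w $ j + \<omega>\<^sup>2 * y $ j + \<omega> * z $ j = 0" "w $ j + \<omega> * y $ j + \<omega>\<^sup>2 * z $ j = 0"
      using u_index[of j 1] u_index[of j 2] that w4 by simp_all
    have "(\<omega>\<^sup>2 - \<omega>) * (y $ j - z $ j)
        = (w $ j + \<omega>\<^sup>2 * y $ j + \<omega> * z $ j) - (w $ j + \<omega> * y $ j + \<omega>\<^sup>2 * z $ j)"
      by (simp add: algebra_simps)
    then have "(\<omega>\<^sup>2 - \<omega>) * (y $ j - z $ j) = 0" using 1 by simp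
    moreover have "\<omega>\<^sup>2 - \<omega> \<noteq> 0" using \<omega>_eq_iff[of 2 1] by simp
    ultimately have "z $ j = y $ j" by simp
    then have "w $ j + (\<omega>\<^sup>2 + \<omega>) * y $ j = 0" using 1(1) by (simp add: algebra_simps)
    moreover have "\<omega>\<^sup>2 + \<omega> = - 1" by (simp add: \<omega>_squared)
    ultimately show ?thesis by simp
  qed
  show "\<exists>a\<in>{1,2}. \<exists>u\<in>W. u \<noteq> 0\<^sub>v n \<and> A *\<^sub>v u = \<omega> ^ a \<cdot>\<^sub>v u" if Aw: "A *\<^sub>v w \<noteq> w"
  proof -
    have "u 1 \<noteq> 0\<^sub>v n \<or> u 2 \<noteq> 0\<^sub>v n"
    proof (rule ccontr)
      assume "\<not> ?thesis"
      then have "w = y" using * car by (intro eq_vecI) auto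
      then show False using Aw unfolding y_def by simp
    qed
    then show ?thesis using u Au by blast
  qed
  show "\<exists>a<3. \<exists>u\<in>W. u \<noteq> 0\<^sub>v n \<and> A *\<^sub>v u = \<omega> ^ a \<cdot>\<^sub>v u" if w0: "w \<noteq> 0\<^sub>v n"
  proof (cases "u 1 = 0\<^sub>v n \<and> u 2 = 0\<^sub>v n")
    case True
    then have "w = y" using * car by (intro eq_vecI) auto
    then have "A *\<^sub>v w = \<omega> ^ 0 \<cdot>\<^sub>v w" unfolding y_def by simp
    then show ?thesis using w w0 by (intro exI[of _ 0]) auto
  next
    case False
    then have "u 1 \<noteq> 0\<^sub>v n \<or> u 2 \<noteq> 0\<^sub>v n" by simp
    moreover have "1 < (3::nat)" "2 < (3::nat)" by auto
    ultimately show ?thesis using u Au by blast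
  qed
qed

locale commuting_cube_roots =
  fixes n :: nat and A :: "nat \<Rightarrow> complex mat"
  assumes carrier: "i < 4 \<Longrightarrow> A i \<in> carrier_mat n n"
    and commute: "i < 4 \<Longrightarrow> j < 4 \<Longrightarrow> A i * A j = A j * A i"
    and cube: "i < 4 \<Longrightarrow> A i * (A i * A i) = 1\<^sub>m n"
    and product: "A 0 * (A 1 * (A 2 * A 3)) = 1\<^sub>m n"
begin

text \<open>Weights are recorded as lists of exponents instead of eigenvalues, so that their orbits
  can be counted by evaluation; the bound 3 makes different lists different weights. The subspace is
  a parameter because irreducibility needs the weights of an arbitrary invariant subspace.\<close>

definition weights :: "complex vec set \<Rightarrow> nat list set" where
  "weights W = {l. length l = 4 \<and> set l \<subseteq> {..<3} \<and>
     (\<exists>u\<in>W. u \<noteq> 0\<^sub>v n \<and> (\<forall>i<4. A i *\<^sub>v u = \<omega> ^ (l ! i) \<cdot>\<^sub>v u))}"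

lemma weights_mono: "W \<subseteq> W' \<Longrightarrow> weights W \<subseteq> weights W'"
  unfolding weights_def by blast

lemma finite_weights: "finite (weights W)"
  by (rule finite_subset[OF _ finite_lists_length_eq[of "{..<3::nat}" 4]])
    (auto simp: weights_def)

lemma lin_closed_eigenspace:
  assumes W: "lin_closed n W" and m: "m \<le> 4"
  shows "lin_closed n {v\<in>W. \<forall>i<m. A i *\<^sub>v v = c i \<cdot>\<^sub>v v}" (is "lin_closed n ?E")
proof -
  note [simp] = mult_add_distrib_mat_vec[OF carrier] mult_mat_vec[OF carrier]
  have 0: "0\<^sub>v n \<in> W" using W unfolding lin_closed_def by blast
  have Ac: "A i \<in> carrier_mat n n" if "i < m" for i using carrier m that by auto
  show ?thesis
    unfolding lin_closed_def
  proof (intro conjI ballI allI)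
    show "?E \<subseteq> carrier_vec n" using lin_closedD(1)[OF W] by blast
    have "A i *\<^sub>v 0\<^sub>v n = c i \<cdot>\<^sub>v 0\<^sub>v n" if "i < m" for i
      using Ac[OF that] by (intro eq_vecI) auto
    then show "0\<^sub>v n \<in> ?E" using 0 by simp
  next
    fix v w assume "v \<in> ?E" "w \<in> ?E"
    then show "v + w \<in> ?E"
      using lin_closedD[OF W] m
      by (auto simp: smult_add_distrib_vec[of _ n])
  next
    fix x v assume "v \<in> ?E"
    then show "x \<cdot>\<^sub>v v \<in> ?E"
      using lin_closedD[OF W] m
      by (auto simp: smult_smult_assoc mult.commute)
  qed
qed

lemma mult_vec_commute:
  assumes "i < 4" "j < 4" "v \<in> carrier_vec n"
  shows "A i *\<^sub>v (A j *\<^sub>v v) = A j *\<^sub>v (A i *\<^sub>v v)"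
  using assms by (metis assoc_mult_mat_vec carrier commute)

lemma eigenspace_invariant:
  assumes W: "lin_closed n W" and AW: "\<And>v. v \<in> W \<Longrightarrow> A j *\<^sub>v v \<in> W" and m: "m \<le> 4" and j: "j < 4"
    and v: "v \<in> {v\<in>W. \<forall>i<m. A i *\<^sub>v v = c i \<cdot>\<^sub>v v}"
  shows "A j *\<^sub>v v \<in> {v\<in>W. \<forall>i<m. A i *\<^sub>v v = c i \<cdot>\<^sub>v v}"
proof -
  have vW: "v \<in> W" "v \<in> carrier_vec n" using v lin_closedD[OF W] by auto
  have "A i *\<^sub>v (A j *\<^sub>v v) = c i \<cdot>\<^sub>v (A j *\<^sub>v v)" if "i < m" for i
    using mult_vec_commute[of i j v] mult_mat_vec[OF carrier[OF j] vW(2)] that m j v vW by auto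
  then show ?thesis using AW[OF vW(1)] by auto
qed

text \<open>One matrix is treated at a time: the joint eigenspace of the first \<open>m\<close>
  matrices is invariant under \<open>A m\<close> because they commute, so an eigenvector of
  \<open>A m\<close> can be found inside it and keeps the eigenvalues already fixed.\<close>

lemma joint_eigenvector:
  assumes "m \<le> 4" and W: "lin_closed n W" and AW: "\<And>i v. i < 4 \<Longrightarrow> v \<in> W \<Longrightarrow> A i *\<^sub>v v \<in> W"
    and w: "w \<in> W" "w \<noteq> 0\<^sub>v n"
  shows "\<exists>a. (\<forall>i<m. a i < 3) \<and> (\<exists>u\<in>W. u \<noteq> 0\<^sub>v n \<and> (\<forall>i<m. A i *\<^sub>v u = \<omega> ^ (a i) \<cdot>\<^sub>v u))"
  using assms(1)
proof (induction m)
  case 0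
  then show ?case using w by blast
next
  case (Suc m)
  then obtain a v where a: "\<forall>i<m. a i < 3" and v: "v \<in> W" "v \<noteq> 0\<^sub>v n" "\<forall>i<m. A i *\<^sub>v v = \<omega> ^ (a i) \<cdot>\<^sub>v v"
    by auto
  define E where "E = {v\<in>W. \<forall>i<m. A i *\<^sub>v v = \<omega> ^ (a i) \<cdot>\<^sub>v v}"
  have m: "m \<le> 4" "m < 4" using Suc.prems by auto
  have "lin_closed n E" unfolding E_def by (rule lin_closed_eigenspace[OF W m(1)])
  moreover have "A m *\<^sub>v x \<in> E" if "x \<in> E" for x
    unfolding E_def
    by (rule eigenspace_invariant[OF W _ m that[unfolded E_def]]) (rule AW[OF m(2)])
  moreover have "v \<in> E" unfolding E_def using v by simp
  ultimately obtain b u where b: "b < 3" and u: "u \<in> E" "u \<noteq> 0\<^sub>v n" "A m *\<^sub>v u = \<omega> ^ b \<cdot>\<^sub>v u"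
    using cube_root_eigenvector(1)[OF carrier cube, of m E v] m v(2) by blast
  have "\<forall>i<Suc m. A i *\<^sub>v u = \<omega> ^ ((a(m := b)) i) \<cdot>\<^sub>v u"
    using u unfolding E_def by (auto simp: less_Suc_eq)
  moreover have "\<forall>i<Suc m. (a(m := b)) i < 3" using a b by (auto simp: less_Suc_eq)
  moreover have "u \<in> W" using u unfolding E_def by blast
  ultimately show ?case using u(2) by blast
qed

lemma weights_nonempty:
  assumes "lin_closed n W" "\<And>i v. i < 4 \<Longrightarrow> v \<in> W \<Longrightarrow> A i *\<^sub>v v \<in> W" "w \<in> W" "w \<noteq> 0\<^sub>v n"
  shows "\<exists>l. l \<in> weights W"
proof -
  obtain a u where "\<forall>i<4. a i < 3" "u \<in> W" "u \<noteq> 0\<^sub>v n" "\<forall>i<4. A i *\<^sub>v u = \<omega> ^ (a i) \<cdot>\<^sub>v u"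
    using joint_eigenvector[OF order.refl assms] by blast
  then have "map a [0..<4] \<in> weights W" unfolding weights_def by auto
  then show ?thesis by blast
qed

lemma nontrivial_weight:
  assumes "A 0 \<noteq> 1\<^sub>m n"
  shows "\<exists>l\<in>weights (carrier_vec n). l ! 0 \<noteq> 0"
proof -
  have A0: "A 0 \<in> carrier_mat n n" by (rule carrier) simp
  have cl: "lin_closed n (carrier_vec n)" unfolding lin_closed_def by auto
  have "\<exists>w\<in>carrier_vec n. A 0 *\<^sub>v w \<noteq> w"
  proof (rule ccontr)
    assume "\<not> ?thesis"
    then have fix_all: "A 0 *\<^sub>v w = w" if "w \<in> carrier_vec n" for w using that by blast
    have "A 0 = 1\<^sub>m n"
    proof (rule eq_matI)
      fix i j assume ij: "i < dim_row (1\<^sub>m n :: complex mat)" "j < dim_col (1\<^sub>m n :: complex mat)"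
      have "A 0 $$ (i, j) = (A 0 *\<^sub>v unit_vec n j) $ i"
        using ij A0 by simp
      then show "A 0 $$ (i, j) = 1\<^sub>m n $$ (i, j)" using fix_all ij by simp
    qed (use A0 in auto)
    then show False using assms by simp
  qed
  then obtain w where w: "w \<in> carrier_vec n" "A 0 *\<^sub>v w \<noteq> w" by blast
  have "\<exists>a\<in>{1,2}. \<exists>u\<in>carrier_vec n. u \<noteq> 0\<^sub>v n \<and> A 0 *\<^sub>v u = \<omega> ^ a \<cdot>\<^sub>v u"
    by (rule cube_root_eigenvector(2)[OF A0 cube cl _ w]) (use A0 in auto)
  then obtain a u where a: "a \<in> {1, 2}" and u: "u \<in> carrier_vec n" "u \<noteq> 0\<^sub>v n" "A 0 *\<^sub>v u = \<omega> ^ a \<cdot>\<^sub>v u"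
    by blast
  \<comment> \<open>The other matrices are diagonalised inside the eigenspace of \<open>A 0\<close>,
    which pins the first exponent of the resulting weight to \<open>a\<close>. The quantifier over
    \<open>i<1\<close> fits this space to the lemmas on joint eigenspaces.\<close>
  define E where "E = {v\<in>carrier_vec n. \<forall>i<1. A i *\<^sub>v v = \<omega> ^ a \<cdot>\<^sub>v v}"
  have clE: "lin_closed n E" unfolding E_def by (rule lin_closed_eigenspace[OF cl]) simp
  have AE: "A i *\<^sub>v v \<in> E" if "i < 4" "v \<in> E" for i v
    using that eigenspace_invariant[OF cl _ _ that(1), of 1 v "\<lambda>_. \<omega> ^ a"]
      mult_mat_vec_carrier[OF carrier[OF that(1)]]
    unfolding E_def by simp
  have "u \<in> E" unfolding E_def using u by simp
  then obtain l where l: "l \<in> weights E" using weights_nonempty[OF clE AE] u(2) by blast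
  then obtain v where v: "v \<in> E" "v \<noteq> 0\<^sub>v n" "A 0 *\<^sub>v v = \<omega> ^ (l ! 0) \<cdot>\<^sub>v v"
    unfolding weights_def by auto
  obtain j where j: "j < n" "v $ j \<noteq> 0"
    using v(1,2) unfolding E_def by (metis (lifting) carrier_vecD eq_vecI index_zero_vec mem_Collect_eq)
  have "\<omega> ^ a \<cdot>\<^sub>v v = \<omega> ^ (l ! 0) \<cdot>\<^sub>v v" using v(1,3) unfolding E_def by simp
  then have "(\<omega> ^ a \<cdot>\<^sub>v v) $ j = (\<omega> ^ (l ! 0) \<cdot>\<^sub>v v) $ j" by simp
  moreover have "v \<in> carrier_vec n" using v(1) unfolding E_def by simp
  ultimately have "\<omega> ^ a = \<omega> ^ (l ! 0)" using j by simp
  then have "l ! 0 \<noteq> 0" using \<omega>_eq_iff[of a "l ! 0"] a by auto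
  moreover have "l \<in> weights (carrier_vec n)"
    using l weights_mono[of E "carrier_vec n"] unfolding E_def by blast
  ultimately show ?thesis by blast
qed

lemma weights_indep:
  assumes W: "W \<subseteq> carrier_vec n" and L: "L \<subseteq> weights W"
  shows "\<exists>w. (\<forall>k<card L. w k \<in> W) \<and> lin_indep n (card L) w"
proof -
  have fin: "finite L" using L finite_weights finite_subset by blast
  obtain e where e: "bij_betw e {..<card L} L"
    using ex_bij_betw_nat_finite[OF fin] by (auto simp: lessThan_atLeast0)
  have eL: "e k \<in> weights W" if "k < card L" for k
    using that e L unfolding bij_betw_def by blast
  then have "\<forall>k<card L. \<exists>u. u \<in> W \<and> u \<noteq> 0\<^sub>v n \<and> (\<forall>i<4. A i *\<^sub>v u = \<omega> ^ (e k ! i) \<cdot>\<^sub>v u)"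
    unfolding weights_def by blast
  then obtain w where w: "\<And>k. k < card L \<Longrightarrow> w k \<in> W \<and> w k \<noteq> 0\<^sub>v n \<and>
      (\<forall>i<4. A i *\<^sub>v w k = \<omega> ^ (e k ! i) \<cdot>\<^sub>v w k)"
    by metis
  have "lin_indep n (card L) w"
    unfolding lin_indep_def
  proof (intro allI impI)
    fix c k assume rel: "\<forall>j<n. (\<Sum>k<card L. c k * w k $ j) = 0" and k: "k < card L"
    show "c k = 0"
    proof (rule joint_eigenvectors_relation[of "{..<4}" A n "{..<card L}" w "\<lambda>k i. \<omega> ^ (e k ! i)"])
      fix s t assume st: "s \<in> {..<card L}" "t \<in> {..<card L}" "s \<noteq> t"
      have ne: "e s \<noteq> e t" using st e unfolding bij_betw_def inj_on_def by blast
      have len: "length (e s) = 4" "length (e t) = 4" "set (e s) \<subseteq> {..<3}" "set (e t) \<subseteq> {..<3}"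
        using eL st unfolding weights_def by auto
      then obtain i where i: "i < 4" "e s ! i \<noteq> e t ! i"
        using ne nth_equalityI[of "e s" "e t"] by auto
      moreover have "e s ! i < 3" "e t ! i < 3"
        using len i by (metis lessThan_iff nth_mem subsetD)+
      ultimately show "\<exists>i\<in>{..<4}. \<omega> ^ (e s ! i) \<noteq> \<omega> ^ (e t ! i)"
        by (intro bexI[of _ i]) (auto simp: \<omega>_eq_iff)
    qed (use carrier w W k rel in auto)
  qed
  then show ?thesis using w by blast
qed

lemma card_weights_le: "card (weights (carrier_vec n)) \<le> n"
  using weights_indep[OF order.refl order.refl] lin_indep_le_dim by blast

lemma many_weights_eq_carrier:
  assumes "lin_closed n W" "n \<le> card (weights W)"
  shows "W = carrier_vec n"
proof -
  obtain w where w: "\<forall>k<card (weights W). w k \<in> W" "lin_indep n (card (weights W)) w"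
    using weights_indep[of W] assms(1) lin_closedD(1) by blast
  moreover have "card (weights W) = n" using lin_indep_le_dim[OF w(2)] assms(2) by simp
  ultimately show ?thesis using lin_indep_closed_eq_carrier[OF assms(1)] by auto
qed

text \<open>The constraint excludes the constant quadruples (1,1,1,1) and (2,2,2,2), which are
  nonzero but have only one arrangement and would spoil the orbit count.\<close>

lemma weight_sum:
  assumes W: "W \<subseteq> carrier_vec n" and l: "l \<in> weights W"
  shows "sum_list l mod 3 = 0"
proof -
  obtain u where u: "u \<in> carrier_vec n" "u \<noteq> 0\<^sub>v n"
    and ev: "\<And>i. i < 4 \<Longrightarrow> A i *\<^sub>v u = \<omega> ^ (l ! i) \<cdot>\<^sub>v u"
    using l W unfolding weights_def by blast
  have len: "length l = 4" using l unfolding weights_def by blast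
  have c: "A 0 \<in> carrier_mat n n" "A 1 \<in> carrier_mat n n" "A 2 \<in> carrier_mat n n"
      "A 3 \<in> carrier_mat n n"
    by (simp_all add: carrier)
  have "A 0 * (A 1 * (A 2 * A 3)) *\<^sub>v u = A 0 *\<^sub>v (A 1 *\<^sub>v (A 2 *\<^sub>v (A 3 *\<^sub>v u)))"
    using assoc_mult_mat_vec[OF c(1) mult_carrier_mat[OF c(2) mult_carrier_mat[OF c(3,4)]] u(1)]
      assoc_mult_mat_vec[OF c(2) mult_carrier_mat[OF c(3,4)] u(1)] assoc_mult_mat_vec[OF c(3,4) u(1)]
    by (simp only:)
  also have "\<dots> = \<omega> ^ (l ! 3) * (\<omega> ^ (l ! 2) * (\<omega> ^ (l ! 1) * \<omega> ^ (l ! 0))) \<cdot>\<^sub>v u"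
    using u(1) ev[of 0] ev[of 1] ev[of 2] ev[of 3]
    by (simp add: smult_smult_assoc mult.assoc mult_mat_vec[OF c(1)] mult_mat_vec[OF c(2), simplified]
        mult_mat_vec[OF c(3)])
  finally have "u = \<omega> ^ (l ! 3) * (\<omega> ^ (l ! 2) * (\<omega> ^ (l ! 1) * \<omega> ^ (l ! 0))) \<cdot>\<^sub>v u"
    unfolding product using u(1) by simp
  then have eq: "u = \<omega> ^ (l ! 0 + l ! 1 + l ! 2 + l ! 3) \<cdot>\<^sub>v u"
    by (simp add: power_add mult_ac)
  obtain j where j: "j < n" "u $ j \<noteq> 0"
    using u by (metis carrier_vecD eq_vecI index_zero_vec)
  have "u $ j = \<omega> ^ (l ! 0 + l ! 1 + l ! 2 + l ! 3) * u $ j"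
    using arg_cong[OF eq, of "\<lambda>v. v $ j"] j u by simp
  then have "\<omega> ^ (l ! 0 + l ! 1 + l ! 2 + l ! 3) = \<omega> ^ 0" using j by simp
  then have "(l ! 0 + l ! 1 + l ! 2 + l ! 3) mod 3 = 0" unfolding \<omega>_eq_iff by simp
  moreover have "sum_list l = l ! 0 + l ! 1 + l ! 2 + l ! 3"
    using len by (simp add: sum_list_sum_nth numeral_eq_Suc)
  ultimately show ?thesis by simp
qed

end

subsection \<open>The weights of a representation\<close>

text \<open>The unit vector e_i has entry sum 1, and so has (1,1,1,1), because 4 is 1 mod 3; their
  difference thus lies in the kernel and is still attached to a single coordinate. The entry -1 is
  written as 2.\<close>

definition base :: "nat \<Rightarrow> gelem" where
  "base i = ((\<lambda>j. if j < 4 \<and> j \<noteq> i then 2 else 0), id)"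

definition perm :: "(nat \<Rightarrow> nat) \<Rightarrow> gelem" where
  "perm \<sigma> = ((\<lambda>_. 0), \<sigma>)"

lemma less_4_cases: "(i::nat) < 4 \<longleftrightarrow> i = 0 \<or> i = 1 \<or> i = 2 \<or> i = 3"
  by auto

lemma sum_4: "(\<Sum>i<(4::nat). f i) = f 0 + f 1 + f 2 + (f 3 :: 'a::comm_monoid_add)"
  by (simp add: numeral_eq_Suc)

lemma G_carrier_iff:
  "(v, \<sigma>) \<in> G_carrier \<longleftrightarrow> (\<forall>i. v i < 3) \<and> (\<forall>i\<ge>4. v i = 0) \<and> (\<Sum>i<4. v i) mod 3 = 0 \<and> \<sigma> permutes {..<4}"
  unfolding G_carrier_def Z30_4_def S4_def by auto

lemma base_in_G: "i < 4 \<Longrightarrow> base i \<in> G_carrier"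
  unfolding base_def G_carrier_iff sum_4 by (auto simp: less_4_cases permutes_id)

lemma perm_in_G: "\<sigma> permutes {..<4} \<Longrightarrow> perm \<sigma> \<in> G_carrier"
  unfolding perm_def G_carrier_iff by simp

lemma G_one_in_G: "G_one \<in> G_carrier"
  unfolding G_one_def G_carrier_iff by (simp add: permutes_id)

lemma G_mult_closed:
  assumes "x \<in> G_carrier" "y \<in> G_carrier"
  shows "G_mult x y \<in> G_carrier"
proof -
  obtain v \<sigma> w \<tau> where xy: "x = (v, \<sigma>)" "y = (w, \<tau>)" by (metis surj_pair)
  have v: "(\<Sum>i<4. v i) mod 3 = 0" and w: "(\<Sum>i<4. w i) mod 3 = 0"
    and \<sigma>: "\<sigma> permutes {..<4}" and \<tau>: "\<tau> permutes {..<4}"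
    using assms unfolding xy G_carrier_iff by auto
  have ws: "(\<Sum>i<4. w (inv_into UNIV \<sigma> i)) = (\<Sum>i<4. w i)"
    using sum.permute[OF permutes_inv[OF \<sigma>], of w] by (simp add: comp_def)
  have "(\<Sum>i<4. (v i + w (inv_into UNIV \<sigma> i)) mod 3) mod 3 = (\<Sum>i<4. v i + w (inv_into UNIV \<sigma> i)) mod 3"
    by (rule mod_sum_eq)
  also have "\<dots> = ((\<Sum>i<4. v i) + (\<Sum>i<4. w i)) mod 3" by (simp add: sum.distrib ws)
  also have "\<dots> = 0" using v w by presburger
  finally show ?thesis
    unfolding xy G_mult_def fst_conv snd_conv G_carrier_iff
    using permutes_compose[OF \<tau> \<sigma>] by simp
qed

lemma G_mult_id: "G_mult (v, id) (w, \<tau>) = ((\<lambda>i. if i < 4 then (v i + w i) mod 3 else 0), \<tau>)"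
  unfolding G_mult_def by (simp add: fun_eq_iff)

lemma base_commute: "G_mult (base i) (base j) = G_mult (base j) (base i)"
  unfolding base_def G_mult_id by (auto simp: fun_eq_iff)

lemma base_cube: "G_mult (base i) (G_mult (base i) (base i)) = G_one"
  unfolding base_def G_mult_id G_one_def by (auto simp: fun_eq_iff)

lemma base_product:
  "G_mult (base 0) (G_mult (base 1) (G_mult (base 2) (base 3))) = G_one"
  unfolding base_def G_mult_id G_one_def by (auto simp: fun_eq_iff less_4_cases)

lemma perm_base:
  assumes "\<sigma> permutes {..<4}"
  shows "G_mult (perm \<sigma>) (base i) = G_mult (base (\<sigma> i)) (perm \<sigma>)"
proof -
  have "inv_into UNIV \<sigma> j < 4 \<longleftrightarrow> j < 4" for j
    using permutes_in_image[OF permutes_inv[OF assms], of j] by simp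
  moreover have "inv_into UNIV \<sigma> j = i \<longleftrightarrow> j = \<sigma> i" for j
    using permutes_inv_eq[OF assms] by auto
  ultimately show ?thesis
    unfolding perm_def base_def G_mult_def by (auto simp: fun_eq_iff)
qed

lemma perm_inverse:
  assumes "\<sigma> permutes {..<4}"
  shows "G_mult (perm (inv_into UNIV \<sigma>)) (perm \<sigma>) = G_one"
  unfolding perm_def G_mult_def G_one_def
  using permutes_inv_o(2)[OF assms] by (auto simp: fun_eq_iff)

lemma is_repD:
  assumes "is_rep n \<rho>"
  shows "g \<in> G_carrier \<Longrightarrow> \<rho> g \<in> carrier_mat n n" "\<rho> G_one = 1\<^sub>m n"
    "g \<in> G_carrier \<Longrightarrow> h \<in> G_carrier \<Longrightarrow> \<rho> (G_mult g h) = \<rho> g * \<rho> h"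
  using assms unfolding is_rep_def by blast+

text \<open>Twelve permutations of \<open>{0, 1, 2, 3}\<close> (the alternating group), listed by their values:
  being doubly transitive, it moves a nontrivial weight to sufficiently many others.\<close>

definition alt4 :: "nat list list" where
  "alt4 = [[0,1,2,3],[1,0,3,2],[2,3,0,1],[3,2,1,0],[0,2,3,1],[0,3,1,2],
     [1,3,2,0],[1,2,0,3],[2,0,1,3],[2,1,3,0],[3,0,2,1],[3,1,0,2]]"

definition orbit4 :: "nat list \<Rightarrow> nat list list" where
  "orbit4 l = map (map ((!) l)) alt4"

lemma alt4_permutes:
  assumes "p \<in> set alt4"
  shows "length p = 4" "(\<lambda>i. if i < 4 then p ! i else i) permutes {..<4}"
proof -
  have "\<forall>p\<in>set alt4. length p = 4 \<and> distinct p \<and> set p = set [0,1,2,3]"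
    by code_simp
  then have p: "length p = 4" "distinct p" "set p = set [0,1,2,3]" using assms by blast+
  then show "length p = 4" by blast
  have "{..<4} = set [0,1,2,3::nat]" by (auto simp: less_4_cases)
  then have "bij_betw ((!) p) {..<4} {..<4}"
    by (intro bij_betw_nth[OF p(2)]) (simp_all only: p)
  then have "bij_betw (\<lambda>i. if i < 4 then p ! i else i) {..<4} {..<4}"
    by (rule iffD1[OF bij_betw_cong, rotated]) simp
  then show "(\<lambda>i. if i < 4 then p ! i else i) permutes {..<4}"
    by (rule bij_imp_permutes) simp
qed

text \<open>Checked by evaluation on all 81 quadruples. Zero is counted along with the orbit because
  the irreducibility argument compares the orbit and the zero weight together with the dimension.
  The bounds 5 and 6 are attained at (0,1,1,1) and (1,1,2,2).\<close>

lemma orbit4_count: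
  assumes "length l = 4" "set l \<subseteq> {..<3}" "sum_list l mod 3 = 0" "l \<noteq> [0, 0, 0, 0]"
  shows "5 \<le> card (insert [0, 0, 0, 0] (set (orbit4 l)))"
    and "6 \<le> card (set (orbit4 l) \<union> set (orbit4 (map (\<lambda>a. 2 * a mod 3) l)))"
proof -
  have count: "\<forall>l\<in>set (List.n_lists 4 [0, 1, 2]). sum_list l mod 3 = 0 \<longrightarrow> l = [0, 0, 0, 0] \<or>
     5 \<le> length (remdups ([0, 0, 0, 0] # orbit4 l)) \<and>
     6 \<le> length (remdups (orbit4 l @ orbit4 (map (\<lambda>a. 2 * a mod 3) l)))"
    by code_simp
  have "{..<3} = set [0, 1, 2::nat]" by auto
  then have "l \<in> set (List.n_lists 4 [0, 1, 2])"
    using assms(1,2) by (simp add: set_n_lists)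
  then have "l = [0, 0, 0, 0] \<or> 5 \<le> length (remdups ([0, 0, 0, 0] # orbit4 l)) \<and>
     6 \<le> length (remdups (orbit4 l @ orbit4 (map (\<lambda>a. 2 * a mod 3) l)))"
    by (intro mp[OF bspec[OF count] assms(3)])
  then have "5 \<le> length (remdups ([0, 0, 0, 0] # orbit4 l)) \<and>
     6 \<le> length (remdups (orbit4 l @ orbit4 (map (\<lambda>a. 2 * a mod 3) l)))"
    using assms(4) by (simp only: simp_thms)
  then show "5 \<le> card (insert [0, 0, 0, 0] (set (orbit4 l)))"
    and "6 \<le> card (set (orbit4 l) \<union> set (orbit4 (map (\<lambda>a. 2 * a mod 3) l)))"
    unfolding length_remdups_card_conv by simp_all
qed

section \<open>Complex representations: orbits of weights, dimension and irreducibility\<close>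

locale complex_rep =
  fixes n :: nat and \<rho> :: "gelem \<Rightarrow> complex mat"
  assumes rep: "is_rep n \<rho>"

sublocale complex_rep \<subseteq> commuting_cube_roots n "\<lambda>i. \<rho> (base i)"
proof
  fix i j :: nat assume ij: "i < 4" "j < 4"
  show "\<rho> (base i) * \<rho> (base j) = \<rho> (base j) * \<rho> (base i)"
    using is_repD(3)[OF rep] base_in_G ij base_commute by metis
next
  fix i :: nat assume i: "i < 4"
  show "\<rho> (base i) \<in> carrier_mat n n" using is_repD(1)[OF rep] base_in_G[OF i] by blast
  show "\<rho> (base i) * (\<rho> (base i) * \<rho> (base i)) = 1\<^sub>m n"
    using is_repD(2,3)[OF rep] base_in_G[OF i] G_mult_closed base_cube by metis
next
  have b: "base 0 \<in> G_carrier" "base 1 \<in> G_carrier" "base 2 \<in> G_carrier" "base 3 \<in> G_carrier"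
    by (simp_all add: base_in_G)
  show "\<rho> (base 0) * (\<rho> (base 1) * (\<rho> (base 2) * \<rho> (base 3))) = 1\<^sub>m n"
    using is_repD(2,3)[OF rep] b G_mult_closed base_product by metis
qed

context complex_rep
begin

text \<open>With \<open>\<tau>\<close> inverse to \<open>\<sigma>\<close>, the relation b_j \<tau> =
  \<tau> b_(\<sigma> j) shows that \<open>\<rho> (perm \<tau>)\<close> carries an eigenvector of
  weight \<open>l\<close> to one whose exponent at \<open>j\<close> is
  \<open>l ! \<sigma> j\<close>. The image is nonzero since \<open>\<rho> (perm \<sigma>)\<close>
  undoes the map.\<close>

lemma weights_permute:
  assumes W: "W \<subseteq> carrier_vec n" and inv: "\<And>g v. g \<in> G_carrier \<Longrightarrow> v \<in> W \<Longrightarrow> \<rho> g *\<^sub>v v \<in> W"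
    and l: "l \<in> weights W" and \<sigma>: "\<sigma> permutes {..<4}"
  shows "map (\<lambda>i. l ! \<sigma> i) [0..<4] \<in> weights W"
proof -
  obtain u where u: "u \<in> W" "u \<noteq> 0\<^sub>v n" and ev: "\<And>i. i < 4 \<Longrightarrow> \<rho> (base i) *\<^sub>v u = \<omega> ^ (l ! i) \<cdot>\<^sub>v u"
    using l unfolding weights_def by blast
  have len: "length l = 4" "set l \<subseteq> {..<3}" using l unfolding weights_def by auto
  have uc: "u \<in> carrier_vec n" using u W by blast
  define \<tau> where "\<tau> = inv_into UNIV \<sigma>"
  have \<tau>: "\<tau> permutes {..<4}" unfolding \<tau>_def by (rule permutes_inv[OF \<sigma>])
  note pG = perm_in_G[OF \<tau>] perm_in_G[OF \<sigma>]
  note pc = is_repD(1)[OF rep pG(1)] is_repD(1)[OF rep pG(2)]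
  have \<sigma>4: "\<sigma> i < 4" if "i < 4" for i using permutes_in_image[OF \<sigma>, of i] that by simp
  have "\<rho> (perm \<tau>) *\<^sub>v u \<noteq> 0\<^sub>v n"
  proof
    assume 0: "\<rho> (perm \<tau>) *\<^sub>v u = 0\<^sub>v n"
    have "G_mult (perm \<sigma>) (perm \<tau>) = G_one"
      using perm_inverse[OF \<tau>] permutes_inv_inv[OF \<sigma>] unfolding \<tau>_def by simp
    then have "\<rho> (perm \<sigma>) * \<rho> (perm \<tau>) = 1\<^sub>m n" using is_repD(2,3)[OF rep] pG by metis
    then have "u = \<rho> (perm \<sigma>) *\<^sub>v (\<rho> (perm \<tau>) *\<^sub>v u)"
      using assoc_mult_mat_vec[OF pc(2,1) uc] uc by simp
    also have "\<dots> = 0\<^sub>v n" unfolding 0 using pc(2) by (intro eq_vecI) auto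
    finally show False using u(2) by simp
  qed
  moreover have "\<rho> (base j) *\<^sub>v (\<rho> (perm \<tau>) *\<^sub>v u) = \<omega> ^ (l ! \<sigma> j) \<cdot>\<^sub>v (\<rho> (perm \<tau>) *\<^sub>v u)"
    if j: "j < 4" for j
  proof -
    have "\<tau> (\<sigma> j) = j" unfolding \<tau>_def using permutes_inverses(2)[OF \<sigma>] by simp
    then have "G_mult (base j) (perm \<tau>) = G_mult (perm \<tau>) (base (\<sigma> j))"
      using perm_base[OF \<tau>, of "\<sigma> j"] by simp
    then have "\<rho> (base j) * \<rho> (perm \<tau>) = \<rho> (perm \<tau>) * \<rho> (base (\<sigma> j))"
      using is_repD(3)[OF rep] pG base_in_G j \<sigma>4 by metis
    then have "\<rho> (base j) *\<^sub>v (\<rho> (perm \<tau>) *\<^sub>v u) = \<rho> (perm \<tau>) *\<^sub>v (\<rho> (base (\<sigma> j)) *\<^sub>v u)"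
      using assoc_mult_mat_vec[OF carrier[OF j] pc(1) uc]
        assoc_mult_mat_vec[OF pc(1) carrier[OF \<sigma>4[OF j]] uc] by simp
    then show ?thesis using ev[OF \<sigma>4[OF j]] mult_mat_vec[OF pc(1) uc] by simp
  qed
  moreover have "\<rho> (perm \<tau>) *\<^sub>v u \<in> W" using inv pG u by blast
  moreover have "l ! \<sigma> i < 3" if "i < 4" for i
    using len \<sigma>4[OF that] by (metis lessThan_iff nth_mem subsetD)
  then have "set (map (\<lambda>i. l ! \<sigma> i) [0..<4]) \<subseteq> {..<3}" by auto
  ultimately show ?thesis unfolding weights_def by auto
qed

lemma orbit4_subset_weights:
  assumes "W \<subseteq> carrier_vec n" "\<And>g v. g \<in> G_carrier \<Longrightarrow> v \<in> W \<Longrightarrow> \<rho> g *\<^sub>v v \<in> W"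
    and "l \<in> weights W"
  shows "set (orbit4 l) \<subseteq> weights W"
proof
  fix m assume "m \<in> set (orbit4 l)"
  then obtain p where p: "p \<in> set alt4" "m = map ((!) l) p" unfolding orbit4_def by auto
  have "m = map (\<lambda>i. l ! (if i < 4 then p ! i else i)) [0..<4]"
    using p(2) alt4_permutes(1)[OF p(1)] by (intro nth_equalityI) auto
  then show "m \<in> weights W"
    using weights_permute[OF assms alt4_permutes(2)[OF p(1)]] by simp
qed

lemma faithful_nontrivial_weight:
  assumes "inj_on \<rho> G_carrier"
  obtains l where "l \<in> weights (carrier_vec n)" "l \<noteq> [0, 0, 0, 0]"
proof -
  have "fst (base 0) 1 \<noteq> fst G_one 1" unfolding base_def G_one_def by simp
  then have "base 0 \<noteq> G_one" by auto
  then have "\<rho> (base 0) \<noteq> \<rho> G_one"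
    using assms base_in_G[of 0] G_one_in_G by (auto dest: inj_onD)
  then have "\<rho> (base 0) \<noteq> 1\<^sub>m n" using is_repD(2)[OF rep] by simp
  then show ?thesis using nontrivial_weight that by fastforce
qed

lemma orbit_count:
  assumes "l \<in> weights (carrier_vec n)" "l \<noteq> [0, 0, 0, 0]"
  shows "5 \<le> card (insert [0, 0, 0, 0] (set (orbit4 l)))"
    and "6 \<le> card (set (orbit4 l) \<union> set (orbit4 (map (\<lambda>a. 2 * a mod 3) l)))"
  using orbit4_count[of l] weight_sum[OF order.refl assms(1)] assms
  unfolding weights_def by auto

lemma carrier_invariant: "g \<in> G_carrier \<Longrightarrow> v \<in> carrier_vec n \<Longrightarrow> \<rho> g *\<^sub>v v \<in> carrier_vec n"
  using is_repD(1)[OF rep] by (rule mult_mat_vec_carrier)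

lemma faithful_dim_ge_4:
  assumes "inj_on \<rho> G_carrier"
  shows "4 \<le> n"
proof -
  obtain l where l: "l \<in> weights (carrier_vec n)" "l \<noteq> [0, 0, 0, 0]"
    using faithful_nontrivial_weight[OF assms] by blast
  have "5 \<le> Suc (card (set (orbit4 l)))"
    using orbit_count(1)[OF l] by (metis card_insert_if List.finite_set le_SucI)
  also have "card (set (orbit4 l)) \<le> card (weights (carrier_vec n))"
    by (rule card_mono[OF finite_weights])
      (rule orbit4_subset_weights[OF order.refl carrier_invariant l(1)])
  also have "\<dots> \<le> n" by (rule card_weights_le)
  finally show ?thesis by simp
qed

lemma faithful_irreducible:
  assumes inj: "inj_on \<rho> G_carrier" and n: "n = 4"
  shows "irred_rep n \<rho>"
  unfolding irred_rep_def
proof (intro conjI allI impI)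
  fix W assume W: "invariant_subspace n \<rho> W"
  have cl: "lin_closed n W" and inv: "\<And>g v. g \<in> G_carrier \<Longrightarrow> v \<in> W \<Longrightarrow> \<rho> g *\<^sub>v v \<in> W"
    using W unfolding invariant_subspace_def lin_closed_def by auto
  have Wc: "W \<subseteq> carrier_vec n" and W0: "0\<^sub>v n \<in> W" using cl unfolding lin_closed_def by auto
  show "W = {0\<^sub>v n} \<or> W = carrier_vec n"
  proof (cases "W = {0\<^sub>v n}")
    case False
    then obtain w where "w \<in> W" "w \<noteq> 0\<^sub>v n" using W0 by blast
    then obtain l where l: "l \<in> weights W"
      using weights_nonempty[OF cl] inv base_in_G by blast
    then have lc: "l \<in> weights (carrier_vec n)" using weights_mono[OF Wc] by blast
    \<comment> \<open>A zero weight in \<open>W\<close> would also be a weight of the whole space,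
      next to the orbit of the nontrivial weight that faithfulness provides.\<close>
    have "l \<noteq> [0, 0, 0, 0]"
    proof
      assume l0: "l = [0, 0, 0, 0]"
      obtain m where m: "m \<in> weights (carrier_vec n)" "m \<noteq> [0, 0, 0, 0]"
        using faithful_nontrivial_weight[OF inj] by blast
      have "insert [0, 0, 0, 0] (set (orbit4 m)) \<subseteq> weights (carrier_vec n)"
        using orbit4_subset_weights[OF order.refl carrier_invariant m(1)] lc l0 by auto
      then have "5 \<le> card (weights (carrier_vec n))"
        using orbit_count(1)[OF m] card_mono[OF finite_weights] by (meson order.trans)
      then show False using card_weights_le n by simp
    qed
    then have "5 \<le> Suc (card (set (orbit4 l)))"
      using orbit_count(1)[OF lc] by (metis card_insert_if List.finite_set le_SucI)
    also have "card (set (orbit4 l)) \<le> card (weights W)"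
      by (rule card_mono[OF finite_weights orbit4_subset_weights[OF Wc inv l]])
    finally have "n \<le> card (weights W)" using n by simp
    then show ?thesis using many_weights_eq_carrier[OF cl] by simp
  qed simp
qed (use rep n in auto)

end

subsection \<open>Real representations and realifications\<close>

lemma map_mat_of_real_mult:
  assumes "A \<in> carrier_mat n n" "B \<in> carrier_mat n n"
  shows "map_mat complex_of_real (A * B) = map_mat complex_of_real A * map_mat complex_of_real B"
  using assms by (intro eq_matI) (auto simp: scalar_prod_def)

lemma is_rep_complexify:
  assumes "is_rep n \<sigma>"
  shows "is_rep n (complexify \<sigma>)"
  unfolding is_rep_def complexify_def
proof (intro conjI ballI)
  fix g assume "g \<in> G_carrier"
  then show "map_mat complex_of_real (\<sigma> g) \<in> carrier_mat n n" using is_repD(1)[OF assms] by simp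
next
  show "map_mat complex_of_real (\<sigma> G_one) = 1\<^sub>m n"
    unfolding is_repD(2)[OF assms] by (intro eq_matI) auto
next
  fix g h assume gh: "g \<in> G_carrier" "h \<in> G_carrier"
  show "map_mat complex_of_real (\<sigma> (G_mult g h))
      = map_mat complex_of_real (\<sigma> g) * map_mat complex_of_real (\<sigma> h)"
    unfolding is_repD(3)[OF assms gh]
    by (rule map_mat_of_real_mult; rule is_repD(1)[OF assms]) (fact gh)+
qed

lemma map_mat_of_real_inj:
  assumes "map_mat complex_of_real A = map_mat complex_of_real B"
  shows "A = B"
proof (rule eq_matI)
  show dim: "dim_row A = dim_row B" "dim_col A = dim_col B"
    using arg_cong[OF assms, of dim_row] arg_cong[OF assms, of dim_col] by simp_all
  fix i j assume ij: "i < dim_row B" "j < dim_col B"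
  have "map_mat complex_of_real A $$ (i, j) = map_mat complex_of_real B $$ (i, j)"
    using assms by simp
  then show "A $$ (i, j) = B $$ (i, j)" using ij dim by simp
qed

text \<open>Real matrices commute with entrywise conjugation of vectors, so the conjugate of a joint
  eigenvector is one for the conjugate eigenvalues.\<close>

lemma real_weights_conj:
  assumes \<sigma>: "is_rep n \<sigma>" and l: "l \<in> commuting_cube_roots.weights n (\<lambda>i. complexify \<sigma> (base i)) (carrier_vec n)"
  shows "map (\<lambda>a. 2 * a mod 3) l \<in> commuting_cube_roots.weights n (\<lambda>i. complexify \<sigma> (base i)) (carrier_vec n)"
proof -
  interpret complex_rep n "complexify \<sigma>" by (unfold_locales) (rule is_rep_complexify[OF \<sigma>])
  obtain u where u: "u \<in> carrier_vec n" "u \<noteq> 0\<^sub>v n"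
    and ev: "\<And>i. i < 4 \<Longrightarrow> complexify \<sigma> (base i) *\<^sub>v u = \<omega> ^ (l ! i) \<cdot>\<^sub>v u"
    using l unfolding weights_def by blast
  have len: "length l = 4" using l unfolding weights_def by blast
  have uc: "map_vec cnj u \<in> carrier_vec n" using u by simp
  have "complexify \<sigma> (base i) *\<^sub>v map_vec cnj u = \<omega> ^ (map (\<lambda>a. 2 * a mod 3) l ! i) \<cdot>\<^sub>v map_vec cnj u"
    if i: "i < 4" for i
  proof -
    have S: "\<sigma> (base i) \<in> carrier_mat n n" using is_repD(1)[OF \<sigma>] base_in_G[OF i] by blast
    have "complexify \<sigma> (base i) *\<^sub>v map_vec cnj u = map_vec cnj (complexify \<sigma> (base i) *\<^sub>v u)"
      using S u(1) by (intro eq_vecI) (auto simp: complexify_def scalar_prod_def)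
    also have "\<dots> = \<omega> ^ (2 * l ! i mod 3) \<cdot>\<^sub>v map_vec cnj u"
      unfolding ev[OF i] cnj_\<omega>_power[symmetric] by (intro eq_vecI) auto
    finally show ?thesis using i len by simp
  qed
  moreover have "map_vec cnj u \<noteq> 0\<^sub>v n"
  proof
    assume 0: "map_vec cnj u = 0\<^sub>v n"
    have "u $ j = 0" if "j < n" for j
      using arg_cong[OF 0, of "\<lambda>v. v $ j"] that u(1) by simp
    then show False using u by (auto intro!: eq_vecI)
  qed
  ultimately show ?thesis using len uc unfolding weights_def by auto
qed

lemma faithful_real_dim_ge_6:
  fixes \<sigma> :: "gelem \<Rightarrow> real mat"
  assumes "faithful_rep n \<sigma>"
  shows "6 \<le> n"
proof -
  have \<sigma>: "is_rep n \<sigma>" and inj: "inj_on \<sigma> G_carrier"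
    using assms unfolding faithful_rep_def by auto
  interpret complex_rep n "complexify \<sigma>" by (unfold_locales) (rule is_rep_complexify[OF \<sigma>])
  have "inj_on (complexify \<sigma>) G_carrier"
    using inj map_mat_of_real_inj unfolding complexify_def inj_on_def by blast
  then obtain l where l: "l \<in> weights (carrier_vec n)" "l \<noteq> [0, 0, 0, 0]"
    using faithful_nontrivial_weight by blast
  have "set (orbit4 l) \<union> set (orbit4 (map (\<lambda>a. 2 * a mod 3) l)) \<subseteq> weights (carrier_vec n)"
    using orbit4_subset_weights[OF order.refl carrier_invariant] l(1) real_weights_conj[OF \<sigma> l(1)]
    by blast
  then have "6 \<le> card (weights (carrier_vec n))"
    using orbit_count(2)[OF l] card_mono[OF finite_weights] order.trans by blast
  then show ?thesis using card_weights_le by simp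
qed

lemma faithful_complex_dim_ge_4:
  fixes \<rho> :: "gelem \<Rightarrow> complex mat"
  assumes "faithful_rep n \<rho>"
  shows "4 \<le> n"
proof -
  interpret complex_rep n \<rho> using assms unfolding faithful_rep_def by unfold_locales blast
  show ?thesis using faithful_dim_ge_4 assms unfolding faithful_rep_def by blast
qed

lemma faithful_4_irreducible:
  fixes \<rho> :: "gelem \<Rightarrow> complex mat"
  assumes "faithful_rep 4 \<rho>"
  shows "irred_rep 4 \<rho>"
proof -
  interpret complex_rep 4 \<rho> using assms unfolding faithful_rep_def by unfold_locales blast
  show ?thesis using faithful_irreducible assms unfolding faithful_rep_def by blast
qed

section \<open>Isomorphisms, direct sums and the realification in dimension 4\<close>

lemma iso_repE:
  assumes "iso_rep n \<rho> \<tau>"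
  obtains P Q where "P \<in> carrier_mat n n" "Q \<in> carrier_mat n n" "P * Q = 1\<^sub>m n" "Q * P = 1\<^sub>m n"
    "\<And>g. g \<in> G_carrier \<Longrightarrow> P * \<rho> g = \<tau> g * P"
proof -
  obtain P where P: "P \<in> carrier_mat n n" "invertible_mat P" "\<And>g. g \<in> G_carrier \<Longrightarrow> P * \<rho> g = \<tau> g * P"
    using assms unfolding iso_rep_def by blast
  obtain Q where Q: "P * Q = 1\<^sub>m n" "Q * P = 1\<^sub>m (dim_row Q)"
    using P(1,2) unfolding invertible_mat_def inverts_mat_def by auto
  have "dim_row Q = n" using arg_cong[OF Q(2), of dim_col] P(1) by simp
  moreover have "dim_col Q = n" using arg_cong[OF Q(1), of dim_col] by simp
  ultimately show ?thesis using that P Q by (metis carrier_matI)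
qed

lemma iso_rep_inj_on:
  assumes "iso_rep n \<rho> \<tau>" "is_rep n \<rho>" "inj_on \<rho> G_carrier"
  shows "inj_on \<tau> G_carrier"
proof (rule inj_onI)
  fix g h assume gh: "g \<in> G_carrier" "h \<in> G_carrier" "\<tau> g = \<tau> h"
  obtain P Q where P: "P \<in> carrier_mat n n" "Q \<in> carrier_mat n n" "Q * P = 1\<^sub>m n"
    and eq: "\<And>g. g \<in> G_carrier \<Longrightarrow> P * \<rho> g = \<tau> g * P"
    using iso_repE[OF assms(1)] by metis
  have \<rho>: "\<rho> x = Q * (P * \<rho> x)" if "x \<in> G_carrier" for x
    using assoc_mult_mat[OF P(2,1) is_repD(1)[OF assms(2) that]] is_repD(1)[OF assms(2) that] P(3)
    by simp
  have "\<rho> g = \<rho> h" using \<rho>[OF gh(1)] \<rho>[OF gh(2)] eq gh by simp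
  then show "g = h" using assms(3) gh by (auto dest: inj_onD)
qed

text \<open>A real form would itself be a faithful real representation of dimension 4, below the
  bound 6.\<close>

lemma faithful_4_not_real:
  assumes "faithful_rep 4 \<rho>"
  shows "\<not> real_rep 4 \<rho>"
proof
  assume "real_rep 4 \<rho>"
  then obtain \<sigma> :: "gelem \<Rightarrow> real mat" where \<sigma>: "is_rep 4 \<sigma>" and iso: "iso_rep 4 \<rho> (complexify \<sigma>)"
    unfolding real_rep_def by blast
  have "inj_on (complexify \<sigma>) G_carrier"
    using iso_rep_inj_on[OF iso] assms unfolding faithful_rep_def by blast
  then have "inj_on \<sigma> G_carrier" unfolding complexify_def inj_on_def by metis
  then have "6 \<le> (4::nat)" using faithful_real_dim_ge_6 \<sigma> unfolding faithful_rep_def by blast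
  then show False by simp
qed

lemma rep_sum_list_carrier:
  assumes "\<forall>(d, r)\<in>set ds. irred_rep d r" "g \<in> G_carrier"
  shows "snd (rep_sum_list ds) g \<in> carrier_mat (fst (rep_sum_list ds)) (fst (rep_sum_list ds))"
  using assms(1)
proof (induction ds)
  case Nil
  then show ?case by simp
next
  case (Cons a ds)
  obtain d r where a: "a = (d, r)" by fastforce
  have "r g \<in> carrier_mat d d"
    using Cons.prems is_repD(1)[OF _ assms(2)] unfolding a irred_rep_def by auto
  then show ?case using Cons unfolding a by (auto simp: rep_sum_def)
qed

text \<open>The first summand, the space of vectors whose last \<open>m\<close> coordinates vanish,
  is invariant because the lower left block is zero.\<close>

lemma rep_sum_mult_vec:
  assumes R: "r g \<in> carrier_mat d d" and S: "s g \<in> carrier_mat m m" and x: "x \<in> carrier_vec (d + m)"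
    and tail: "\<And>j. d \<le> j \<Longrightarrow> j < d + m \<Longrightarrow> x $ j = 0" and j: "d \<le> j" "j < d + m"
  shows "(rep_sum d r m s g *\<^sub>v x) $ j = (0 :: 'a::field)"
proof -
  have dims: "dim_row (r g) = d" "dim_col (r g) = d" "dim_row (s g) = m" "dim_col (s g) = m"
    using R S by auto
  have "(rep_sum d r m s g *\<^sub>v x) $ j
      = (\<Sum>k<d + m. rep_sum d r m s g $$ (j, k) * x $ k)"
    using j x dims by (auto simp: rep_sum_def scalar_prod_def lessThan_atLeast0)
  also have "\<dots> = 0"
  proof (rule sum.neutral, rule ballI)
    fix k assume "k \<in> {..<d + m}"
    then show "rep_sum d r m s g $$ (j, k) * x $ k = 0"
      using j dims tail[of k] by (cases "k < d") (auto simp: rep_sum_def)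
  qed
  finally show ?thesis .
qed

text \<open>The first summand is pulled back along the isomorphism \<open>P\<close> to an invariant
  subspace \<open>U\<close>. It contains the preimage of the basis vector 0, as
  \<open>d > 0\<close>, and for \<open>m > 0\<close> it misses the preimage of the basis vector
  \<open>d\<close>, so it would be neither zero nor everything.\<close>

lemma irreducible_rep_sum_trivial:
  fixes \<rho> :: "gelem \<Rightarrow> 'a::field mat"
  assumes irr: "irred_rep (d + m) \<rho>" and iso: "iso_rep (d + m) \<rho> (rep_sum d r m s)" and d: "d > 0"
    and r: "\<And>g. g \<in> G_carrier \<Longrightarrow> r g \<in> carrier_mat d d"
    and s: "\<And>g. g \<in> G_carrier \<Longrightarrow> s g \<in> carrier_mat m m"
  shows "m = 0"
proof (rule ccontr)
  assume "m \<noteq> 0"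
  define n where "n = d + m"
  have rep: "is_rep n \<rho>" using irr unfolding irred_rep_def n_def by blast
  obtain P Q where P: "P \<in> carrier_mat n n" "Q \<in> carrier_mat n n" "P * Q = 1\<^sub>m n" "Q * P = 1\<^sub>m n"
    and eq: "\<And>g. g \<in> G_carrier \<Longrightarrow> P * \<rho> g = rep_sum d r m s g * P"
    using iso_repE[OF iso] unfolding n_def by metis
  note Pv = mult_add_distrib_mat_vec[OF P(1)] mult_mat_vec[OF P(1)]
  have rs: "rep_sum d r m s g \<in> carrier_mat n n" if "g \<in> G_carrier" for g
    using r[OF that] s[OF that] unfolding rep_sum_def n_def by simp
  define U where "U = {u\<in>carrier_vec n. \<forall>j. d \<le> j \<longrightarrow> j < n \<longrightarrow> (P *\<^sub>v u) $ j = 0}"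
  have PQ: "P *\<^sub>v (Q *\<^sub>v x) = x" if "x \<in> carrier_vec n" for x
    using assoc_mult_mat_vec[OF P(1,2) that] P(3) that by simp
  have Qc: "Q *\<^sub>v x \<in> carrier_vec n" if "x \<in> carrier_vec n" for x
    using P(2) that by simp
  have dimP: "dim_vec (P *\<^sub>v u) = n" for u using P(1) by simp
  have P0: "P *\<^sub>v 0\<^sub>v n = 0\<^sub>v n" using P(1) by (intro eq_vecI) auto
  have "invariant_subspace n \<rho> U"
    unfolding invariant_subspace_def
  proof (intro conjI ballI allI)
    show "U \<subseteq> carrier_vec n" unfolding U_def by blast
    show "0\<^sub>v n \<in> U" unfolding U_def using P0 by simp
  next
    fix v w assume "v \<in> U" "w \<in> U"
    then show "v + w \<in> U" unfolding U_def using dimP by (auto simp: Pv simp del: index_mult_mat_vec)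
  next
    fix c v assume "v \<in> U"
    then show "c \<cdot>\<^sub>v v \<in> U" unfolding U_def using dimP by (auto simp: Pv simp del: index_mult_mat_vec)
  next
    fix g v assume g: "g \<in> G_carrier" and v: "v \<in> U"
    have vc: "v \<in> carrier_vec n" and tail: "\<And>j. d \<le> j \<Longrightarrow> j < d + m \<Longrightarrow> (P *\<^sub>v v) $ j = 0"
      using v unfolding U_def n_def by auto
    have \<rho>c: "\<rho> g \<in> carrier_mat n n" by (rule is_repD(1)[OF rep g])
    have Pvc: "P *\<^sub>v v \<in> carrier_vec (d + m)" using P(1) vc unfolding n_def by simp
    have "P *\<^sub>v (\<rho> g *\<^sub>v v) = rep_sum d r m s g *\<^sub>v (P *\<^sub>v v)"
      using assoc_mult_mat_vec[OF P(1) \<rho>c vc] assoc_mult_mat_vec[OF rs[OF g] P(1) vc] eq[OF g]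
      by simp
    then show "\<rho> g *\<^sub>v v \<in> U"
      unfolding U_def using rep_sum_mult_vec[of r g d s m, OF r[OF g] s[OF g] Pvc tail] \<rho>c vc
      by (simp add: n_def)
  qed
  then consider "U = {0\<^sub>v n}" | "U = carrier_vec n"
    using irr unfolding irred_rep_def n_def by blast
  then show False
  proof cases
    case 1
    have "Q *\<^sub>v unit_vec n 0 \<in> U"
      unfolding U_def using PQ[of "unit_vec n 0"] Qc[of "unit_vec n 0"] d by simp
    then have "P *\<^sub>v (Q *\<^sub>v unit_vec n 0) = 0\<^sub>v n" using 1 P0 by simp
    then have "unit_vec n 0 = (0\<^sub>v n :: 'a vec)" using PQ[of "unit_vec n 0"] by simp
    then show False using d unfolding n_def by simp
  next
    case 2
    have dn: "d < n" using \<open>m \<noteq> 0\<close> unfolding n_def by simp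
    have "Q *\<^sub>v unit_vec n d \<in> U" using 2 Qc[of "unit_vec n d"] by simp
    then have "(P *\<^sub>v (Q *\<^sub>v unit_vec n d)) $ d = 0" using dn unfolding U_def by simp
    then show False using PQ[of "unit_vec n d"] dn by simp
  qed
qed

text \<open>As \<open>\<rho>\<close> is irreducible and non-real, its only decomposition has one piece, and the
  realification has dimension 8.\<close>

lemma realification_faithful_4:
  assumes faithful: "faithful_rep 4 \<rho>" and real: "realification 4 \<rho> k \<tau>"
  shows "k = 8"
proof -
  obtain ds where irr: "\<forall>(d, r)\<in>set ds. irred_rep d r" and dim: "fst (rep_sum_list ds) = 4"
    and iso: "iso_rep 4 \<rho> (snd (rep_sum_list ds))"
    and k: "k = 4 + fst (rep_sum_list [(d, conj_rep r). (d, r) \<leftarrow> ds, \<not> real_rep d r])"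
    using real unfolding realification_def Let_def by blast
  obtain a ds' where ds: "ds = a # ds'" using dim by (cases ds) auto
  obtain d r where a: "a = (d, r)" by fastforce
  define m s where "m = fst (rep_sum_list ds')" and "s = snd (rep_sum_list ds')"
  have r: "is_rep d r" "d > 0" using irr unfolding ds a irred_rep_def by auto
  have dm: "d + m = 4" using dim unfolding ds a m_def by simp
  have iso': "iso_rep 4 \<rho> (rep_sum d r m s)" using iso unfolding ds a m_def s_def by simp
  have s: "s g \<in> carrier_mat m m" if "g \<in> G_carrier" for g
    using rep_sum_list_carrier[OF _ that, of ds'] irr unfolding ds m_def s_def by simp
  have m0: "m = 0"
    using irreducible_rep_sum_trivial[of d m \<rho> r s] iso' faithful_4_irreducible[OF faithful] r s dm
      is_repD(1)[OF r(1)] by simp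
  have "ds' = []"
  proof (rule ccontr)
    assume "ds' \<noteq> []"
    then obtain e t ds'' where ds': "ds' = (e, t) # ds''" by (metis list.exhaust surj_pair)
    have "e > 0" using irr unfolding ds ds' irred_rep_def by auto
    then show False using m0 unfolding m_def ds' by simp
  qed
  have d4: "d = 4" using dm m0 by simp
  \<comment> \<open>\<open>realification\<close> tests the reality of the piece \<open>r\<close>,
    which is only isomorphic to \<open>\<rho>\<close>. Faithfulness is therefore transported to
    \<open>r\<close>, and non-reality follows from it.\<close>
  have "inj_on (rep_sum d r m s) G_carrier"
    using iso_rep_inj_on[OF iso'] faithful unfolding faithful_rep_def by blast
  then have "inj_on r G_carrier"
    unfolding inj_on_def rep_sum_def using \<open>ds' = []\<close> by (simp add: s_def)
  then have "\<not> real_rep d r"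
    using faithful_4_not_real[of r] r(1) unfolding d4 faithful_rep_def by blast
  then show ?thesis using k unfolding ds a \<open>ds' = []\<close> d4 by simp
qed

subsection \<open>Faithful representations of minimal dimension\<close>

text \<open>Both minimal representations act on functions on a finite set, the vertices or the edges
  of the tetrahedron. Composition and faithfulness are verified on kernels indexed by that set, and
  its arbitrary numbering \<open>e\<close> is confined to this proof.\<close>

lemma faithful_rep_of_kernel:
  fixes K :: "gelem \<Rightarrow> 'x \<Rightarrow> 'x \<Rightarrow> 'a::field"
  assumes X: "finite X" "card X = n"
    and one: "\<And>A B. A \<in> X \<Longrightarrow> B \<in> X \<Longrightarrow> K G_one A B = (if A = B then 1 else 0)"
    and mult: "\<And>g h A C. g \<in> G_carrier \<Longrightarrow> h \<in> G_carrier \<Longrightarrow> A \<in> X \<Longrightarrow> C \<in> X \<Longrightarrow>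
      K (G_mult g h) A C = (\<Sum>B\<in>X. K g A B * K h B C)"
    and inj: "\<And>g h. g \<in> G_carrier \<Longrightarrow> h \<in> G_carrier \<Longrightarrow>
      (\<And>A B. A \<in> X \<Longrightarrow> B \<in> X \<Longrightarrow> K g A B = K h A B) \<Longrightarrow> g = h"
  shows "\<exists>\<rho> :: gelem \<Rightarrow> 'a mat. faithful_rep n \<rho>"
proof -
  obtain e where e: "bij_betw e {..<n} X"
    using ex_bij_betw_nat_finite[OF X(1)] X(2) by (auto simp: lessThan_atLeast0)
  have eX: "e i \<in> X" if "i < n" for i using e that unfolding bij_betw_def by blast
  have e_eq: "e i = e j \<longleftrightarrow> i = j" if "i < n" "j < n" for i j
    using e that unfolding bij_betw_def inj_on_def by blast
  define \<rho> where "\<rho> g = mat n n (\<lambda>(i, j). K g (e i) (e j))" for g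
  have "is_rep n \<rho>"
    unfolding is_rep_def
  proof (intro conjI ballI)
    show "\<rho> g \<in> carrier_mat n n" for g unfolding \<rho>_def by simp
    show "\<rho> G_one = 1\<^sub>m n"
      unfolding \<rho>_def by (intro eq_matI) (auto simp: one eX e_eq)
  next
    fix g h assume gh: "g \<in> G_carrier" "h \<in> G_carrier"
    show "\<rho> (G_mult g h) = \<rho> g * \<rho> h"
    proof (rule eq_matI)
      fix i j assume "i < dim_row (\<rho> g * \<rho> h)" "j < dim_col (\<rho> g * \<rho> h)"
      then have ij: "i < n" "j < n" unfolding \<rho>_def by simp_all
      have "(\<rho> g * \<rho> h) $$ (i, j) = (\<Sum>k<n. K g (e i) (e k) * K h (e k) (e j))"
        using ij by (simp add: \<rho>_def scalar_prod_def lessThan_atLeast0)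
      also have "\<dots> = (\<Sum>B\<in>X. K g (e i) B * K h B (e j))"
        using sum.reindex_bij_betw[OF e, of "\<lambda>B. K g (e i) B * K h B (e j)"] by simp
      also have "\<dots> = \<rho> (G_mult g h) $$ (i, j)"
        using ij mult[OF gh] eX by (simp add: \<rho>_def)
      finally show "\<rho> (G_mult g h) $$ (i, j) = (\<rho> g * \<rho> h) $$ (i, j)" by simp
    qed (simp_all add: \<rho>_def)
  qed
  moreover have "inj_on \<rho> G_carrier"
  proof (rule inj_onI)
    fix g h assume gh: "g \<in> G_carrier" "h \<in> G_carrier" "\<rho> g = \<rho> h"
    show "g = h"
    proof (rule inj[OF gh(1,2)])
      fix A B assume AB: "A \<in> X" "B \<in> X"
      then obtain i j where ij: "i < n" "A = e i" "j < n" "B = e j"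
        using e unfolding bij_betw_def by auto
      then show "K g A B = K h A B"
        using arg_cong[OF gh(3), of "\<lambda>M. M $$ (i, j)"] unfolding \<rho>_def by simp
    qed
  qed
  ultimately show ?thesis unfolding faithful_rep_def by blast
qed

lemma permutes_eqI:
  assumes "\<sigma> permutes {..<n::nat}" "\<tau> permutes {..<n}" "\<And>i. i < n \<Longrightarrow> \<sigma> i = \<tau> i"
  shows "\<sigma> = \<tau>"
proof
  fix i show "\<sigma> i = \<tau> i" using assms unfolding permutes_def by (cases "i < n") auto
qed

lemma G_carrier_cases:
  assumes "g \<in> G_carrier"
  obtains v \<sigma> where "g = (v, \<sigma>)" "\<forall>i. v i < 3" "\<forall>i\<ge>4. v i = 0" "(\<Sum>i<4. v i) mod 3 = 0"
    "\<sigma> permutes {..<4}"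
  using assms that by (cases g) (auto simp: G_carrier_iff)

text \<open>The kernel is a diagonal matrix with entries \<open>\<omega> ^ v i\<close> times the
  permutation matrix of \<open>\<sigma>\<close>. The weights of the b_j are the four arrangements of
  (0,2,2,2).\<close>

lemma exists_faithful_complex_4: "\<exists>\<rho> :: gelem \<Rightarrow> complex mat. faithful_rep 4 \<rho>"
proof (rule faithful_rep_of_kernel[where X = "{..<4}"
      and K = "\<lambda>g i j. if snd g j = i then \<omega> ^ fst g i else 0"])
  fix g h and i j :: nat assume g: "g \<in> G_carrier" and h: "h \<in> G_carrier" and ij: "i \<in> {..<4}" "j \<in> {..<4}"
  obtain v \<sigma> where g': "g = (v, \<sigma>)" and \<sigma>: "\<sigma> permutes {..<4}" using g by (rule G_carrier_cases)
  obtain w \<tau> where h': "h = (w, \<tau>)" and \<tau>: "\<tau> permutes {..<4}" using h by (rule G_carrier_cases)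
  have \<tau>j: "\<tau> j < 4" using permutes_in_image[OF \<tau>, of j] ij by simp
  have "(\<Sum>k<4. (if \<sigma> k = i then \<omega> ^ v i else 0) * (if \<tau> j = k then \<omega> ^ w k else 0))
      = (\<Sum>k<4. if k = \<tau> j then (if \<sigma> k = i then \<omega> ^ v i * \<omega> ^ w k else 0) else 0)"
    by (intro sum.cong) auto
  also have "\<dots> = (if \<sigma> (\<tau> j) = i then \<omega> ^ v i * \<omega> ^ w (\<tau> j) else 0)"
    using \<tau>j by simp
  also have "\<dots> = (if \<sigma> (\<tau> j) = i then \<omega> ^ ((v i + w (inv_into UNIV \<sigma> i)) mod 3) else 0)"
    using permutes_inverses(2)[OF \<sigma>] by (auto simp: \<omega>_mod power_add)
  finally show "(if snd (G_mult g h) j = i then \<omega> ^ fst (G_mult g h) i else 0)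
      = (\<Sum>k<4. (if snd g k = i then \<omega> ^ fst g i else 0) * (if snd h j = k then \<omega> ^ fst h k else 0))"
    unfolding g' h' G_mult_def fst_conv snd_conv using ij by simp
next
  fix g h assume g: "g \<in> G_carrier" and h: "h \<in> G_carrier"
    and eq: "\<And>i j. i \<in> {..<4} \<Longrightarrow> j \<in> {..<4} \<Longrightarrow>
      (if snd g j = i then \<omega> ^ fst g i else 0) = (if snd h j = i then \<omega> ^ fst h i else 0)"
  obtain v \<sigma> where g': "g = (v, \<sigma>)" and v: "\<forall>i. v i < 3" "\<forall>i\<ge>4. v i = 0"
    and \<sigma>: "\<sigma> permutes {..<4}" using g by (rule G_carrier_cases)
  obtain w \<tau> where h': "h = (w, \<tau>)" and w: "\<forall>i. w i < 3" "\<forall>i\<ge>4. w i = 0"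
    and \<tau>: "\<tau> permutes {..<4}" using h by (rule G_carrier_cases)
  have \<sigma>4: "\<sigma> j < 4" if "j < 4" for j using permutes_in_image[OF \<sigma>, of j] that by simp
  \<comment> \<open>The only nonzero entry of column \<open>j\<close> stands in row
    \<open>\<sigma> j\<close>; it locates \<open>\<sigma> j\<close> and its value gives the exponent
    there.\<close>
  have st: "\<sigma> j = \<tau> j" and vw: "\<omega> ^ v (\<sigma> j) = \<omega> ^ w (\<sigma> j)" if j: "j < 4" for j
    using eq[of "\<sigma> j" j] \<sigma>4[OF j] j \<omega>_neq_0 unfolding g' h' by (auto split: if_splits)
  have "v i = w i" for i
  proof (cases "i < 4")
    case True
    then have "inv_into UNIV \<sigma> i < 4" using permutes_in_image[OF permutes_inv[OF \<sigma>], of i] by simp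
    then have "\<omega> ^ v i = \<omega> ^ w i" using vw permutes_inverses(1)[OF \<sigma>] by metis
    then show ?thesis using v w by (simp add: \<omega>_eq_iff)
  qed (use v w in simp)
  then show "g = h" unfolding g' h' using permutes_eqI[OF \<sigma> \<tau> st] by auto
qed (auto simp: G_one_def)

section \<open>The real representation on the edges of the tetrahedron\<close>

definition edges :: "nat set set" where
  "edges = {A. A \<subseteq> {..<4} \<and> card A = 2}"

lemma edges_finite_card: "finite edges" "card edges = 6"
proof -
  have "finite (Pow {..<4::nat})" by simp
  then show "finite edges" by (rule rev_finite_subset) (auto simp: edges_def)
  show "card edges = 6"
    using n_subsets[of "{..<4::nat}" 2] unfolding edges_def by (simp add: numeral_eq_Suc)
qed

lemma edges_Compl: "A \<in> edges \<Longrightarrow> {..<4} - A \<in> edges"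
  unfolding edges_def by (auto simp: card_Diff_subset finite_subset)

lemma edges_image:
  assumes "\<sigma> permutes {..<4}" "A \<in> edges"
  shows "\<sigma> ` A \<in> edges"
proof -
  have "\<sigma> ` A \<subseteq> {..<4}" using assms permutes_image[OF assms(1)] unfolding edges_def by blast
  moreover have "card (\<sigma> ` A) = card A"
    by (rule card_image[OF inj_on_subset[OF permutes_inj[OF assms(1)]]]) simp
  ultimately show ?thesis using assms(2) unfolding edges_def by simp
qed

lemma edges_neq_Compl: "A \<in> edges \<Longrightarrow> A \<noteq> {..<4} - A"
  unfolding edges_def by (cases "A = {}") auto

lemma permutes_image_eq_iff:
  assumes "\<sigma> permutes S"
  shows "\<sigma> ` B = A \<longleftrightarrow> B = inv_into UNIV \<sigma> ` A"
proof -
  have "\<sigma> ` inv_into UNIV \<sigma> ` A = A" "inv_into UNIV \<sigma> ` \<sigma> ` B = B"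
    unfolding image_image using permutes_inverses[OF assms] by simp_all
  then show ?thesis by metis
qed

lemma permutes_image_Compl:
  assumes "\<sigma> permutes S"
  shows "\<sigma> ` (S - A) = S - \<sigma> ` A"
  using image_set_diff[OF permutes_inj[OF assms], of S A] permutes_image[OF assms] by simp

text \<open>The monomial representation on functions \<open>f\<close> on the six edges of the tetrahedron, \<open>(v, \<sigma>)\<close>
  multiplying \<open>f(A)\<close> by \<open>\<omega>\<close> to the power \<open>v(A)\<close>, preserves the real form
  \<open>f(complement of A) = cnj (f A)\<close>. The kernel below is its action in the
  real coordinate \<open>Re (f A) + Im (f A)\<close>, which determines \<open>f\<close>.\<close>

definition edge_kernel :: "gelem \<Rightarrow> nat set \<Rightarrow> nat set \<Rightarrow> real" where
  "edge_kernel g A B = (if snd g ` B = A then Re (\<omega> ^ sum (fst g) A) else 0)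
     + (if snd g ` B = {..<4} - A then Im (\<omega> ^ sum (fst g) A) else 0)"

text \<open>As the entries sum to 0 mod 3, complementary edges carry opposite exponents. This is
  what makes the action compatible with the real form.\<close>

lemma \<omega>_power_Compl:
  fixes w :: "nat \<Rightarrow> nat"
  assumes "A \<subseteq> {..<4}" "(\<Sum>i<4. w i) mod 3 = 0"
  shows "\<omega> ^ sum w ({..<4} - A) = cnj (\<omega> ^ sum w A)"
proof -
  have "sum w ({..<4} - A) + sum w A = (\<Sum>i<4. w i)"
    using assms(1) by (simp add: sum.subset_diff[of A "{..<4}"])
  then have "(sum w ({..<4} - A) + sum w A) mod 3 = 0" using assms(2) by simp
  moreover have "(x + y) mod 3 = 0 \<Longrightarrow> x mod 3 = (2 * y) mod 3" for x y :: nat by presburger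
  ultimately have "sum w ({..<4} - A) mod 3 = (2 * sum w A) mod 3" by metis
  then show ?thesis unfolding cnj_\<omega>_power by (simp add: \<omega>_eq_iff)
qed

text \<open>Let x(A) = Re f(A) + Im f(A); then x of the complement is Re f(A) - Im f(A), and
  multiplying f(A) by \<open>p\<close> turns x(A) into Re p times x(A) plus Im p times x of the
  complement. So each row of the kernel has two possible entries, at the edge \<open>B1\<close> that
  \<open>\<sigma>\<close> maps to \<open>A\<close> and at its complement \<open>B2\<close>, and
  composition becomes the product \<open>p * q\<close> of complex numbers.\<close>

lemma edge_kernel_mult:
  assumes g: "g \<in> G_carrier" and h: "h \<in> G_carrier" and A: "A \<in> edges" and C: "C \<in> edges"
  shows "edge_kernel (G_mult g h) A C = (\<Sum>B\<in>edges. edge_kernel g A B * edge_kernel h B C)"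
proof -
  obtain v \<sigma> where g': "g = (v, \<sigma>)" and \<sigma>: "\<sigma> permutes {..<4}" using g by (rule G_carrier_cases)
  obtain w \<tau> where h': "h = (w, \<tau>)" and w: "(\<Sum>i<4. w i) mod 3 = 0" and \<tau>: "\<tau> permutes {..<4}"
    using h by (rule G_carrier_cases)
  define B1 where "B1 = inv_into UNIV \<sigma> ` A"
  define B2 where "B2 = {..<4} - B1"
  note i\<sigma> = permutes_inv[OF \<sigma>]
  have B: "B1 \<in> edges" "B2 \<in> edges"
    unfolding B1_def B2_def using edges_image[OF i\<sigma> A] edges_Compl by auto
  have A4: "A \<subseteq> {..<4}" and B14: "B1 \<subseteq> {..<4}" using A B unfolding edges_def by auto
  have B1': "B1 = {..<4} - B2" using B14 unfolding B2_def by auto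
  have img: "\<sigma> ` B = A \<longleftrightarrow> B = B1" "\<sigma> ` B = {..<4} - A \<longleftrightarrow> B = B2" for B
    unfolding permutes_image_eq_iff[OF \<sigma>] B1_def B2_def permutes_image_Compl[OF i\<sigma>] by simp_all
  define p where "p = \<omega> ^ sum v A"
  define q where "q = \<omega> ^ sum w B1"
  have q2: "\<omega> ^ sum w B2 = cnj q" unfolding q_def B2_def by (rule \<omega>_power_Compl[OF B14 w])
  have "(\<Sum>i\<in>A. w (inv_into UNIV \<sigma> i)) = sum w B1"
    unfolding B1_def by (subst sum.reindex[OF inj_on_subset[OF permutes_inj[OF i\<sigma>]]]) simp_all
  then have "p * q = \<omega> ^ (\<Sum>i\<in>A. v i + w (inv_into UNIV \<sigma> i))"
    unfolding p_def q_def by (simp add: sum.distrib power_add)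
  also have "\<dots> = \<omega> ^ (\<Sum>i\<in>A. (v i + w (inv_into UNIV \<sigma> i)) mod 3)"
    unfolding \<omega>_eq_iff by (simp add: mod_sum_eq)
  also have "(\<Sum>i\<in>A. (v i + w (inv_into UNIV \<sigma> i)) mod 3) = sum (fst (G_mult g h)) A"
    unfolding g' h' G_mult_def using A4 by (intro sum.cong) auto
  finally have pq: "\<omega> ^ sum (fst (G_mult g h)) A = p * q" by simp
  have snd_gh: "snd (G_mult g h) ` C = \<sigma> ` \<tau> ` C" unfolding g' h' G_mult_def by (simp add: image_comp)
  have "edge_kernel g A B = (if B = B1 then Re p else 0) + (if B = B2 then Im p else 0)" for B
    unfolding edge_kernel_def g' fst_conv snd_conv img p_def by simp
  then have "edge_kernel g A B * edge_kernel h B C = (if B = B1 then Re p * edge_kernel h B C else 0)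
      + (if B = B2 then Im p * edge_kernel h B C else 0)" for B
    by (cases "B = B1"; cases "B = B2") (simp_all add: distrib_right)
  then have "(\<Sum>B\<in>edges. edge_kernel g A B * edge_kernel h B C)
      = Re p * edge_kernel h B1 C + Im p * edge_kernel h B2 C"
    using B edges_finite_card(1) by (simp add: sum.distrib)
  \<comment> \<open>In the row of \<open>B2\<close> the phase is \<open>cnj q\<close> and the
    complement is \<open>B1\<close>, hence the sign of \<open>Im q\<close>.\<close>
  also have "\<dots> = Re p * ((if \<tau> ` C = B1 then Re q else 0) + (if \<tau> ` C = B2 then Im q else 0))
      + Im p * ((if \<tau> ` C = B2 then Re q else 0) + (if \<tau> ` C = B1 then - Im q else 0))"
    unfolding edge_kernel_def h' fst_conv snd_conv q2 q_def[symmetric] B2_def[symmetric] B1'[symmetric]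
    by simp
  also have "\<dots> = (if \<tau> ` C = B1 then Re (p * q) else 0) + (if \<tau> ` C = B2 then Im (p * q) else 0)"
    by (simp add: algebra_simps)
  also have "\<dots> = edge_kernel (G_mult g h) A C"
    unfolding edge_kernel_def pq snd_gh img by simp
  finally show ?thesis by simp
qed

text \<open>The squares of the real parts are 1 or 1/4, those of the imaginary parts 0 or 3/4. An
  entry of the edge kernel that is a real part can thus be told from zero and from every imaginary
  part, so the kernel reveals how the permutation moves the edges.\<close>

lemma Re_\<omega>_power_neq_Im: "Re (\<omega> ^ a) \<noteq> Im (\<omega> ^ b)" "Re (\<omega> ^ a) \<noteq> 0"
proof -
  have "a mod 3 \<in> {0, 1, 2}" "b mod 3 \<in> {0, 1, 2}" by auto
  then have "\<omega> ^ a \<in> {1, \<omega>, - 1 - \<omega>}" "\<omega> ^ b \<in> {1, \<omega>, - 1 - \<omega>}"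
    using \<omega>_mod[of a] \<omega>_mod[of b] by (auto simp: \<omega>_squared)
  then have "(Re (\<omega> ^ a))\<^sup>2 \<in> {1, 1 / 4}" "(Im (\<omega> ^ b))\<^sup>2 \<in> {0, 3 / 4}"
    by (auto simp: \<omega>_Re_Im power_divide)
  then show "Re (\<omega> ^ a) \<noteq> Im (\<omega> ^ b)" "Re (\<omega> ^ a) \<noteq> 0" by auto
qed

lemma two_others:
  assumes "(i::nat) < 4"
  shows "\<exists>j k. j < 4 \<and> k < 4 \<and> i \<noteq> j \<and> i \<noteq> k \<and> j \<noteq> k"
proof (intro exI)
  show "(i + 1) mod 4 < 4 \<and> (i + 2) mod 4 < 4 \<and> i \<noteq> (i + 1) mod 4 \<and> i \<noteq> (i + 2) mod 4 \<and>
      (i + 1) mod 4 \<noteq> (i + 2) mod 4"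
    using assms unfolding less_4_cases by auto
qed

text \<open>The three sums determine 2a = (a + b) + (a + c) - (b + c), and 2 is invertible mod 3. In
  this way the values on the edges of a triangle determine those at its vertices.\<close>

lemma pairwise_sums_mod_3:
  fixes a b c d e f :: nat
  assumes "(a + b) mod 3 = (d + e) mod 3" "(a + c) mod 3 = (d + f) mod 3"
    "(b + c) mod 3 = (e + f) mod 3" "a < 3" "d < 3"
  shows "a = d"
proof -
  have *: "(x + y) mod 3 = (x mod 3 + y mod 3) mod 3" for x y :: nat by (simp add: mod_add_eq)
  have "((a + a) + (b + c)) mod 3 = ((d + d) + (e + f)) mod 3"
    using mod_add_cong[OF assms(1,2)] by (simp only: ac_simps)
  moreover obtain r where "(b + c) mod 3 = r" "(e + f) mod 3 = r" "r < 3" using assms(3) by simp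
  moreover have "a \<in> {0,1,2}" "d \<in> {0,1,2}" using assms(4,5) by auto
  moreover from calculation have "r = 0 \<or> r = 1 \<or> r = 2" by linarith
  ultimately show ?thesis unfolding *[of "a + a"] *[of "d + d"] by (elim disjE insertE emptyE; simp)
qed
lemma edge_kernel_inj:
  assumes g: "g \<in> G_carrier" and h: "h \<in> G_carrier"
    and eq: "\<And>A B. A \<in> edges \<Longrightarrow> B \<in> edges \<Longrightarrow> edge_kernel g A B = edge_kernel h A B"
  shows "g = h"
proof -
  obtain v \<sigma> where g': "g = (v, \<sigma>)" and v: "\<forall>i. v i < 3" "\<forall>i\<ge>4. v i = 0"
    and \<sigma>: "\<sigma> permutes {..<4}" using g by (rule G_carrier_cases)
  obtain w \<tau> where h': "h = (w, \<tau>)" and w: "\<forall>i. w i < 3" "\<forall>i\<ge>4. w i = 0"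
    and \<tau>: "\<tau> permutes {..<4}" using h by (rule G_carrier_cases)
  have img: "\<sigma> ` B = \<tau> ` B" if B: "B \<in> edges" for B
  proof -
    define A where "A = \<sigma> ` B"
    have A: "A \<in> edges" unfolding A_def by (rule edges_image[OF \<sigma> B])
    have "edge_kernel g A B = Re (\<omega> ^ sum v A)"
      unfolding edge_kernel_def g' using edges_neq_Compl[OF A] by (simp add: A_def)
    then have "edge_kernel h A B = Re (\<omega> ^ sum v A)" using eq[OF A B] by simp
    moreover have "edge_kernel h A B \<in> {0, Im (\<omega> ^ sum w A)}" if "\<tau> ` B \<noteq> A"
      unfolding edge_kernel_def h' using that by simp
    ultimately have "\<tau> ` B = A" using Re_\<omega>_power_neq_Im[of "sum v A"] by auto
    then show ?thesis unfolding A_def by simp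
  qed
  have edge: "{i, j} \<in> edges" if "i < 4" "j < 4" "i \<noteq> j" for i j
    using that unfolding edges_def by auto
  \<comment> \<open>Two edges through \<open>i\<close> meet only in \<open>i\<close>, so the image
    of \<open>i\<close> is the common vertex of their images.\<close>
  have st: "\<sigma> i = \<tau> i" if i: "i < 4" for i
  proof -
    obtain j k where jk: "j < 4" "k < 4" "i \<noteq> j" "i \<noteq> k" "j \<noteq> k"
      using two_others[OF i] by blast
    have "\<tau> j \<noteq> \<tau> k" using permutes_inj[OF \<tau>] jk unfolding inj_on_def by blast
    moreover have "\<sigma> i \<in> {\<tau> i, \<tau> j}" using img[OF edge[OF i jk(1,3)]] by auto
    moreover have "\<sigma> i \<in> {\<tau> i, \<tau> k}" using img[OF edge[OF i jk(2,4)]] by auto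
    ultimately show ?thesis by auto
  qed
  have \<sigma>\<tau>: "\<sigma> = \<tau>" by (rule permutes_eqI[OF \<sigma> \<tau> st])
  have vw: "sum v A mod 3 = sum w A mod 3" if A: "A \<in> edges" for A
  proof -
    define B where "B = inv_into UNIV \<sigma> ` A"
    have B: "B \<in> edges" unfolding B_def by (rule edges_image[OF permutes_inv[OF \<sigma>] A])
    have B': "\<sigma> ` B = A" unfolding permutes_image_eq_iff[OF \<sigma>] B_def by (rule refl)
    have C: "\<sigma> ` ({..<4} - B) = {..<4} - A" using permutes_image_Compl[OF \<sigma>] B' by simp
    note neq = edges_neq_Compl[OF A]
    \<comment> \<open>In row \<open>A\<close>, the column \<open>B\<close> with image
      \<open>A\<close> shows the real part of the phase, and the column of the complement of
      \<open>B\<close> its imaginary part.\<close>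
    have "Re (\<omega> ^ sum v A) = Re (\<omega> ^ sum w A)"
      using eq[OF A B] neq B' unfolding edge_kernel_def g' h' \<sigma>\<tau>[symmetric] by simp
    moreover have "Im (\<omega> ^ sum v A) = Im (\<omega> ^ sum w A)"
      using eq[OF A edges_Compl[OF B]] neq C unfolding edge_kernel_def g' h' \<sigma>\<tau>[symmetric] by simp
    ultimately show ?thesis unfolding \<omega>_eq_iff[symmetric] by (simp add: complex_eq_iff)
  qed
  have "v i = w i" for i
  proof (cases "i < 4")
    case True
    obtain j k where jk: "j < 4" "k < 4" "i \<noteq> j" "i \<noteq> k" "j \<noteq> k"
      using two_others[OF True] by blast
    have "(v i + v j) mod 3 = (w i + w j) mod 3" "(v i + v k) mod 3 = (w i + w k) mod 3"
      "(v j + v k) mod 3 = (w j + w k) mod 3"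
      using vw[OF edge[OF True jk(1,3)]] vw[OF edge[OF True jk(2,4)]] vw[OF edge[OF jk(1,2,5)]] jk
      by simp_all
    moreover have "v i < 3" "w i < 3" using v w by simp_all
    ultimately show ?thesis by (rule pairwise_sums_mod_3)
  qed (use v w in simp)
  then show ?thesis unfolding g' h' \<sigma>\<tau> by auto
qed

lemma exists_faithful_real_6: "\<exists>\<sigma> :: gelem \<Rightarrow> real mat. faithful_rep 6 \<sigma>"
proof (rule faithful_rep_of_kernel[where X = edges and K = edge_kernel])
  show "edge_kernel G_one A B = (if A = B then 1 else 0)" for A B
    unfolding edge_kernel_def G_one_def by simp
qed (use edges_finite_card edge_kernel_mult edge_kernel_inj in blast)+

theorem theorem5p3:
  shows "mdim TYPE(complex) = 4 \<and> mdim TYPE(real) = 6 \<and>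
    (\<forall>\<rho> :: gelem \<Rightarrow> complex mat. faithful_rep 4 \<rho> \<longrightarrow> irred_rep 4 \<rho> \<and> \<not> real_rep 4 \<rho>) \<and>
    \<not> (\<exists>(\<rho> :: gelem \<Rightarrow> complex mat) (\<sigma> :: gelem \<Rightarrow> real mat).
         faithful_rep 4 \<rho> \<and> faithful_rep 6 \<sigma> \<and> realification 4 \<rho> 6 (complexify \<sigma>))"
proof (intro conjI)
  show "mdim TYPE(complex) = 4"
    unfolding mdim_def
    by (rule Least_equality) (use exists_faithful_complex_4 faithful_complex_dim_ge_4 in blast)+
  show "mdim TYPE(real) = 6"
    unfolding mdim_def
    by (rule Least_equality) (use exists_faithful_real_6 faithful_real_dim_ge_6 in blast)+
  show "\<forall>\<rho> :: gelem \<Rightarrow> complex mat. faithful_rep 4 \<rho> \<longrightarrow> irred_rep 4 \<rho> \<and> \<not> real_rep 4 \<rho>"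
    using faithful_4_irreducible faithful_4_not_real by blast
  show "\<not> (\<exists>(\<rho> :: gelem \<Rightarrow> complex mat) (\<sigma> :: gelem \<Rightarrow> real mat).
         faithful_rep 4 \<rho> \<and> faithful_rep 6 \<sigma> \<and> realification 4 \<rho> 6 (complexify \<sigma>))"
  proof
    assume "\<exists>(\<rho> :: gelem \<Rightarrow> complex mat) (\<sigma> :: gelem \<Rightarrow> real mat).
         faithful_rep 4 \<rho> \<and> faithful_rep 6 \<sigma> \<and> realification 4 \<rho> 6 (complexify \<sigma>)"
    then have "(6::nat) = 8" using realification_faithful_4 by blast
    then show False by simp
  qed
qed

end
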